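(* Let $(F,\mu)\in\{(\mathcal{E},\sigma),(\mathcal{E}_p,\sigma_p)\}$, where in the second case the fixed directions satisfy $\mathrm{Span}(\theta_1,\dots,\theta_p)=\mathbb{R}^d$. Let $a>0$, $\eta:=\mathcal{N}(0,I_{nd})$ on $\mathbb{R}^{n\times d}$, let $\nu$ be a probability measure on $\mathbb{R}^{n\times d}$ absolutely continuous with respect to the Lebesgue measure, and let $(\alpha^{(t)})_{t\in\mathbb{N}}$ satisfy $\alpha^{(t)}\ge0$ for all $t$, $\sum_{t=0}^{+\infty}\alpha^{(t)}=+\infty$ and $\sum_{t=0}^{+\infty}(\alpha^{(t)})^2<+\infty$. Let $(Y^{(t)})$ be a trajectory of $$Y^{(t+1)}=Y^{(t)}-\alpha^{(t)}\varphi(Y^{(t)},\theta^{(t+1)})+\alpha^{(t)}a\,\varepsilon^{(t+1)},\quad \big(Y^{(0)},(\theta^{(t)})_t,(\varepsilon^{(t)})_t\big)\sim\nu\otimes\mu^{\otimes\mathbb{N}}\otimes\eta^{\otimes\mathbb{N}},$$ and assume that $(Y^{(t)})$ is almost surely bounded. Then the sequence $F(Y^{(t)})$ is almost surely convergent and, almost surely, any subsequential limit of $(Y^{(t)})$ belongs to the set $\{Y\in\mathbb{R}^{n\times d}:0\in\partial_CF(Y)\}$ of Clarke critical points of $F$.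
   Context: Let $n,d\ge1$. A matrix $Y\in\mathbb{R}^{n\times d}$ is written $Y=(y_1,\dots,y_n)^T$ with rows $y_k\in\mathbb{R}^d$, $\gamma_Y:=\frac1n\sum_k\delta_{y_k}$. Fix $Z\in\mathbb{R}^{n\times d}$. $\sigma$ is the uniform probability measure on the unit sphere $\mathbb{S}^{d-1}$, and for fixed directions $\theta_1,\dots,\theta_p\in\mathbb{S}^{d-1}$, $\sigma_p:=\frac1p\sum_{i=1}^p\delta_{\theta_i}$. With $P_\theta(x)=\theta^Tx$, $\#$ the push-forward and $\mathrm{W}_2$ the 2-Wasserstein distance, set $w_\theta(Y):=\mathrm{W}_2^2(P_\theta\#\gamma_Y,P_\theta\#\gamma_Z)$, $\mathcal{E}(Y):=\int w_\theta(Y)\,d\sigma(\theta)$, $\mathcal{E}_p(Y):=\int w_\theta(Y)\,d\sigma_p(\theta)$; these are locally Lipschitz functions of $Y$. For $\theta\in\mathbb{S}^{d-1}$, $\tau_X^\theta$ is a permutation with $\theta^Tx_{\tau_X^\theta(1)}\le\dots\le\theta^Tx_{\tau_X^\theta(n)}$ (arbitrary measurable choice when ambiguous). The almost-everywhere gradient of $(Y,\theta)\mapsto w_\theta(Y)$ in $Y$ is $\varphi(Y,\theta)\in\mathbb{R}^{n\times d}$ whose $k$-th row is (the transpose of) $\frac2n\theta\theta^T\big(y_k-z_{\tau_Z^\theta\circ(\tau_Y^\theta)^{-1}(k)}\big)$. For $f:\mathbb{R}^D\to\mathbb{R}$ locally Lipschitz with differentiability set $\mathcal{D}_f$, the Clarke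 sub-differential is $\partial_Cf(x):=\mathrm{conv}\{v:\exists(x_i)\in\mathcal{D}_f^{\mathbb{N}},\ x_i\to x,\ \nabla f(x_i)\to v\}$. *)

theory Defs
  imports "HOL-Probability.Probability"
begin

text \<open>
  A matrix with \<open>n\<close> rows in \<open>d\<close>-dimensional space is an element of \<^typ>\<open>real^'d^'n\<close>, the
  \<open>k\<close>-th row being \<open>Y $ k\<close>. The inner product and norm of this type are the Frobenius ones,
  and \<open>lborel\<close> on it is the \<open>n d\<close>-dimensional Lebesgue measure. The row index type is linearly
  ordered because permutations sorting the rows are considered.
\<close>

section \<open>Measures\<close>

text \<open>The measure \<open>1/|I| \<Sum>i\<in>I. \<delta>(x i)\<close>, for finite non-empty \<open>I\<close>.\<close>

definition empirical_measure :: "'i set \<Rightarrow> ('i \<Rightarrow> 'a::topological_space) \<Rightarrow> 'a measure" where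
  "empirical_measure I x = distr (uniform_count_measure I) borel x"

lemma emeasure_empirical_measure:
  assumes "finite I" "I \<noteq> {}" "A \<in> sets borel"
  shows "emeasure (empirical_measure I x) A = ennreal ((\<Sum>i\<in>I. indicator A (x i)) / real (card I))"
proof -
  have "emeasure (empirical_measure I x) A = emeasure (uniform_count_measure I) (x -` A \<inter> I)"
    unfolding empirical_measure_def using assms
    by (subst emeasure_distr) (auto simp: space_uniform_count_measure measurable_def sets_uniform_count_measure)
  also have "\<dots> = ennreal (card (x -` A \<inter> I) / card I)"
    using assms by (subst emeasure_uniform_count_measure) auto
  also have "real (card (x -` A \<inter> I)) = (\<Sum>i\<in>I. indicator A (x i))"
    using assms by (simp add: indicator_def Int_def vimage_def conj_commute flip: sum.inter_filter)
  finally show ?thesis .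
qed

text \<open>
  The uniform probability measure on the unit sphere, as a Borel measure on the ambient space:
  the law of \<open>x / |x|\<close> for \<open>x\<close> uniform in the unit ball (normalised cone measure). It is the
  rotation invariant Borel probability measure carried by the sphere, see the lemmas below.
\<close>

definition sphere_uniform :: "'a::euclidean_space measure" where
  "sphere_uniform = distr (uniform_measure lborel (ball 0 1)) borel (\<lambda>x. x /\<^sub>R norm x)"

lemma emeasure_lborel_unit_ball_pos: "emeasure lborel (ball (0::'a::euclidean_space) 1) \<noteq> 0"
proof -
  have "measure lborel (ball (0::'a) 1) > 0"
    by (rule content_ball_pos) simp
  then show ?thesis
    by (auto simp: measure_def)
qed

lemma prob_space_sphere_uniform: "prob_space (sphere_uniform :: 'a::euclidean_space measure)"
proof -
  interpret B: prob_space "uniform_measure lborel (ball (0::'a) 1)"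
    using emeasure_lborel_unit_ball_pos emeasure_lborel_ball_finite[of "0::'a" 1]
    by (intro prob_space_uniform_measure) auto
  show ?thesis
    unfolding sphere_uniform_def by (rule B.prob_space_distr) simp
qed

lemma AE_sphere_uniform: "AE \<theta> in sphere_uniform. \<theta> \<in> sphere (0::'a::euclidean_space) 1"
proof -
  have "AE x in lborel. x \<noteq> (0::'a)"
    by (rule AE_lborel_singleton)
  then have "AE x in uniform_measure lborel (ball (0::'a) 1). x /\<^sub>R norm x \<in> sphere 0 1"
    by (intro AE_uniform_measureI) auto
  then show ?thesis
    unfolding sphere_uniform_def by (subst AE_distr_iff) (auto simp del: mem_sphere)
qed

lemma sphere_uniform_rotation_invariant:
  fixes f :: "real^'d::{finite,wellorder} \<Rightarrow> real^'d::_"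
  assumes f: "orthogonal_transformation f"
  shows "distr sphere_uniform borel f = sphere_uniform"
proof (rule measure_eqI)
  show "sets (distr sphere_uniform borel f) = sets (sphere_uniform :: (real^'d::{finite,wellorder}) measure)"
    by (simp add: sphere_uniform_def)
next
  fix A assume "A \<in> sets (distr (sphere_uniform :: (real^'d::{finite,wellorder}) measure) borel f)"
  then have A [measurable]: "A \<in> sets borel" by simp
  have lin: "linear f" and nf: "\<And>x. norm (f x) = norm x"
    using f by (simp_all add: orthogonal_transformation)
  have f_meas [measurable]: "f \<in> borel_measurable borel"
    using lin by (intro borel_measurable_continuous_onI linear_continuous_on linear_conv_bounded_linear[THEN iffD1])
  let ?p = "\<lambda>x::real^'d::{finite,wellorder}. x /\<^sub>R norm x"
  have p_f: "f (?p x) = ?p (f x)" for x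
    using lin nf by (simp add: linear_scale)
  have fA: "f -` A \<in> sets borel" and pA: "?p -` A \<in> sets borel"
    using measurable_sets[of f borel borel A] measurable_sets[of ?p borel borel A] by simp_all
  then have pfA: "?p -` (f -` A) \<in> sets borel"
    using measurable_sets[of ?p borel borel "f -` A"] by simp
  define S T where "S = ball 0 1 \<inter> ?p -` A" and "T = ball 0 1 \<inter> ?p -` (f -` A)"
  have [measurable]: "S \<in> sets borel" "T \<in> sets borel"
    unfolding S_def T_def using pA pfA by (auto intro: sets.Int)
  have "f ` T = S"
  proof
    show "f ` T \<subseteq> S" by (auto simp: S_def T_def p_f nf)
    show "S \<subseteq> f ` T"
    proof
      fix y assume "y \<in> S"
      moreover obtain x where "y = f x" using orthogonal_transformation_surj[OF f] by (metis surjD)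
      ultimately show "y \<in> f ` T" by (auto simp: S_def T_def p_f nf)
    qed
  qed
  have bdd: "bounded S" "bounded T"
    unfolding S_def T_def by (rule bounded_subset[OF bounded_ball Int_lower1])+
  then have lm: "S \<in> lmeasurable" "T \<in> lmeasurable"
    using \<open>S \<in> sets borel\<close> \<open>T \<in> sets borel\<close>
    by (intro bounded_set_imp_lmeasurable sets_completionI_sets; simp)+
  have "measure lebesgue S = measure lebesgue T"
    using measure_orthogonal_image[OF f lm(2)] \<open>f ` T = S\<close> by simp
  then have "emeasure lebesgue S = emeasure lebesgue T"
    using emeasure_eq_measure2[OF lm(1)] emeasure_eq_measure2[OF lm(2)] by simp
  then have eq: "emeasure lborel S = emeasure lborel T"
    using \<open>S \<in> sets borel\<close> \<open>T \<in> sets borel\<close> by simp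
  have "emeasure (distr sphere_uniform borel f) A = emeasure sphere_uniform (f -` A)"
    by (subst emeasure_distr) (auto simp: sphere_uniform_def)
  also have "\<dots> = emeasure (uniform_measure lborel (ball 0 1)) (?p -` (f -` A))"
    unfolding sphere_uniform_def using fA by (subst emeasure_distr) auto
  also have "\<dots> = emeasure lborel T / emeasure lborel (ball (0::real^'d::{finite,wellorder}) 1)"
    unfolding T_def using pfA by (subst emeasure_uniform_measure) auto
  also have "\<dots> = emeasure (uniform_measure lborel (ball 0 1)) (?p -` A)"
    unfolding eq[symmetric] unfolding S_def using pA by (subst emeasure_uniform_measure) auto
  also have "\<dots> = emeasure sphere_uniform A"
    unfolding sphere_uniform_def by (subst emeasure_distr) auto
  finally show "emeasure (distr sphere_uniform borel f) A = emeasure sphere_uniform A" .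
qed

text \<open>The Gaussian measure \<open>\<N>(0, Id)\<close> of a Euclidean space.\<close>

definition standard_gaussian :: "'a::euclidean_space measure" where
  "standard_gaussian = density lborel (\<lambda>x. ennreal (\<Prod>b\<in>Basis. std_normal_density (x \<bullet> b)))"

section \<open>Wasserstein distance and sliced energies\<close>

definition couplings :: "'a measure \<Rightarrow> 'b measure \<Rightarrow> ('a \<times> 'b) measure set" where
  "couplings M N = {\<pi>. sets \<pi> = sets (M \<Otimes>\<^sub>M N) \<and> distr \<pi> M fst = M \<and> distr \<pi> N snd = N}"

text \<open>
  The 2-Wasserstein distance of Borel probability measures with finite second moments (the
  infimum is then finite, so that \<open>enn2real\<close> loses nothing).
\<close>

definition wasserstein2 :: "'a::metric_space measure \<Rightarrow> 'a measure \<Rightarrow> real" where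
  "wasserstein2 M N =
     sqrt (enn2real (INF \<pi>\<in>couplings M N. \<integral>\<^sup>+z. ennreal ((dist (fst z) (snd z))\<^sup>2) \<partial>\<pi>))"

definition row_measure :: "real^'d^'n \<Rightarrow> (real^'d) measure" where
  "row_measure Y = empirical_measure UNIV (\<lambda>k. Y $ k)"

definition sliced_w2_sq :: "real^'d^'n \<Rightarrow> real^'d \<Rightarrow> real^'d^'n \<Rightarrow> real" where
  "sliced_w2_sq Z \<theta> Y = (wasserstein2 (distr (row_measure Y) borel (\<lambda>x. \<theta> \<bullet> x)) (distr (row_measure Z) borel (\<lambda>x. \<theta> \<bullet> x)))\<^sup>2"

definition energy :: "(real^'d) measure \<Rightarrow> real^'d^'n \<Rightarrow> real^'d^'n \<Rightarrow> real" where
  "energy \<mu> Z Y = (\<integral>\<theta>. sliced_w2_sq Z \<theta> Y \<partial>\<mu>)"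

section \<open>Almost-everywhere gradient\<close>

text \<open>
  \<open>\<tau> X \<theta>\<close> is a permutation of the row indices sorting the projections of the rows of \<open>X\<close>; the
  choice in case of ties is Borel measurable in \<open>(X, \<theta>)\<close>. Only directions on the sphere matter.
\<close>

definition sorting_choice :: "(real^'d^'n::{finite,linorder} \<Rightarrow> real^'d \<Rightarrow> 'n \<Rightarrow> 'n) \<Rightarrow> bool" where
  "sorting_choice \<tau> \<longleftrightarrow>
     (\<forall>X. \<forall>\<theta>\<in>sphere 0 1. bij (\<tau> X \<theta>) \<and> mono (\<lambda>i. \<theta> \<bullet> (X $ \<tau> X \<theta> i))) \<and>
     (\<lambda>(X, \<theta>). \<tau> X \<theta>) \<in> borel \<Otimes>\<^sub>M restrict_space borel (sphere 0 1) \<rightarrow>\<^sub>M count_space UNIV"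

definition phi :: "(real^'d^'n \<Rightarrow> real^'d \<Rightarrow> 'n \<Rightarrow> 'n) \<Rightarrow> real^'d^'n \<Rightarrow> real^'d^'n \<Rightarrow> real^'d \<Rightarrow> real^'d^'n" where
  "phi \<tau> Z Y \<theta> =
     (\<chi> k. (2 / real CARD('n)) *\<^sub>R ((\<theta> \<bullet> (Y $ k - Z $ (\<tau> Z \<theta> \<circ> inv (\<tau> Y \<theta>)) k)) *\<^sub>R \<theta>))"

section \<open>Clarke sub-differential\<close>

definition clarke_subdifferential :: "('a::euclidean_space \<Rightarrow> real) \<Rightarrow> 'a \<Rightarrow> 'a set" where
  "clarke_subdifferential f x =
     convex hull {v. \<exists>xs gs. (\<forall>i::nat. GDERIV f (xs i) :> gs i) \<and> xs \<longlonglongrightarrow> x \<and> gs \<longlonglongrightarrow> v}"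

end

theory Submission
  imports Defs
begin

text \<open>
  For a fixed direction, optimal transport on the line matches sorted projections, so
  \<open>w\<^sub>\<theta>(Y)\<close> is a minimum over permutations of quadratic costs. Hence it is semiconcave: for every
  \<open>Y'\<close>, \<open>w\<^sub>\<theta>(Y') \<le> w\<^sub>\<theta>(Y) + \<langle>\<phi>(Y,\<theta>), Y' - Y\<rangle> + |Y' - Y|\<^sup>2\<close>, and integration gives the same inequality for
  \<open>F\<close> with the mean field \<open>g(Y) = \<integral> \<phi>(Y,\<theta>) d\<mu>(\<theta>)\<close>. This is a descent inequality just as for smooth
  functions, and it makes differential inclusions and Sard type arguments unnecessary: the noise
  is a martingale with square summable increments on bounded trajectories, so \<open>F(Y\<^sub>t)\<close> converges and
  \<open>\<Sum> \<alpha>\<^sub>t |g(Y\<^sub>t)|\<^sup>2 < \<infinity>\<close>. A trajectory cannot stay near a point around which \<open>|g|\<close> is bounded below,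
  and it cannot leave such a neighbourhood infinitely often at the cost of a finite dissipation. So
  near every limit point there are iterates with arbitrarily small \<open>g(Y\<^sub>t)\<close>.

  Almost every \<open>Y\<close> has, for almost every \<open>\<theta>\<close>, pairwise distinct projections; there \<open>g\<close> is continuous and, by
  semiconcavity, the gradient of \<open>F\<close>. The Gaussian noise keeps the law of every iterate absolutely
  continuous, so along the trajectory \<open>g(Y\<^sub>t)\<close> is almost surely the gradient of \<open>F\<close>, and 0 is a limit
  of gradients at every limit point.
\<close>

section \<open>Square integrable martingales\<close>

text \<open>Kolmogorov's inequality. The martingale property is expressed as orthogonality of
  \<open>D j\<close> to every \<open>G j\<close>-measurable \<open>X\<close> with integrable
  product, which avoids conditional expectations. Orthogonality makes second moments add up, and
  stopping preserves this because the stopping factor at time \<open>i\<close> is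
  \<open>G i\<close>-measurable.\<close>

lemma (in prob_space) martingale_maximal_inequality:
  fixes D :: "nat \<Rightarrow> 'a \<Rightarrow> real" and G :: "nat \<Rightarrow> 'a measure"
  assumes sub: "\<And>j. subalgebra M (G j)"
    and ad: "\<And>i j. i < j \<Longrightarrow> D i \<in> borel_measurable (G j)"
    and sq: "\<And>j. integrable M (\<lambda>\<omega>. (D j \<omega>)\<^sup>2)"
    and orth: "\<And>j X. X \<in> borel_measurable (G j) \<Longrightarrow> integrable M (\<lambda>\<omega>. X \<omega> * D j \<omega>) \<Longrightarrow>
      expectation (\<lambda>\<omega>. X \<omega> * D j \<omega>) = 0"
    and e: "e > 0"
  shows "prob {\<omega>\<in>space M. \<exists>k\<le>n. e \<le> \<bar>\<Sum>i<k. D i \<omega>\<bar>} \<le> (\<Sum>i<n. expectation (\<lambda>\<omega>. (D i \<omega>)\<^sup>2)) / e\<^sup>2"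
proof -
  define S where "S k \<omega> = (\<Sum>i<k. D i \<omega>)" for k \<omega>
  \<comment> \<open>\<open>S'\<close> is \<open>S\<close> stopped when it first leaves \<open>]-e, e[\<close>; Markov's inequality is applied to it.\<close>
  define B where "B i \<omega> = (if \<forall>j\<le>i. \<bar>S j \<omega>\<bar> < e then 1 else 0 :: real)" for i \<omega>
  define S' where "S' k \<omega> = (\<Sum>i<k. B i \<omega> * D i \<omega>)" for k \<omega>
  have measG: "X \<in> borel_measurable M" if "X \<in> borel_measurable (G j)" for X :: "'a \<Rightarrow> real" and j
    using that sub measurable_from_subalg by blast
  have D_M [measurable]: "D i \<in> borel_measurable M" for i
    by (rule measG[OF ad[of i "Suc i"]]) simp
  have S_G: "S k \<in> borel_measurable (G j)" if "k \<le> j" for k j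
    unfolding S_def[abs_def] using that by (intro borel_measurable_sum ad) auto
  have B_G: "B i \<in> borel_measurable (G j)" if "i \<le> j" for i j
  proof -
    have [measurable]: "S k \<in> borel_measurable (G j)" if "k \<in> {..i}" for k
      using that \<open>i \<le> j\<close> by (intro S_G) auto
    have "(\<lambda>\<omega>. if \<forall>k\<in>{..i}. \<bar>S k \<omega>\<bar> < e then 1 else 0 :: real) \<in> borel_measurable (G j)"
      by measurable
    then show ?thesis by (simp add: B_def[abs_def] Ball_def)
  qed
  have S'_G: "S' k \<in> borel_measurable (G j)" if "k \<le> j" for k j
    unfolding S'_def[abs_def] using that by (intro borel_measurable_sum borel_measurable_times ad B_G) auto
  have [measurable]: "S k \<in> borel_measurable M" "B k \<in> borel_measurable M" "S' k \<in> borel_measurable M" for k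
    using measG[OF S_G[OF order_refl]] measG[OF B_G[OF order_refl]] measG[OF S'_G[OF order_refl]] by blast+
  have B01: "0 \<le> B i \<omega>" "B i \<omega> \<le> 1" "\<bar>B i \<omega>\<bar> \<le> 1" for i \<omega>
    by (auto simp: B_def)
  have S': "integrable M (\<lambda>\<omega>. (S' k \<omega>)\<^sup>2) \<and>
      expectation (\<lambda>\<omega>. (S' k \<omega>)\<^sup>2) \<le> (\<Sum>i<k. expectation (\<lambda>\<omega>. (D i \<omega>)\<^sup>2))" for k
  proof (induction k)
    case 0
    show ?case by (simp add: S'_def)
  next
    case (Suc k)
    \<comment> \<open>The cross term has mean zero by \<open>orth\<close>, since \<open>S' k\<close>
      and \<open>B k\<close> are both \<open>G k\<close>-measurable.\<close>
    have eq: "(S' (Suc k) \<omega>)\<^sup>2 = (S' k \<omega>)\<^sup>2 + (B k \<omega> * D k \<omega>)\<^sup>2 + 2 * ((S' k \<omega> * B k \<omega>) * D k \<omega>)" for \<omega>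
      by (simp add: S'_def power2_eq_square algebra_simps)
    have i1: "integrable M (\<lambda>\<omega>. (S' k \<omega>)\<^sup>2)" using Suc by simp
    have le: "(B k \<omega> * D k \<omega>)\<^sup>2 \<le> (D k \<omega>)\<^sup>2" for \<omega>
      using B01[of k \<omega>] by (auto simp: power_mult_distrib power_le_one mult_left_le_one_le)
    have i2: "integrable M (\<lambda>\<omega>. (B k \<omega> * D k \<omega>)\<^sup>2)"
      by (rule Bochner_Integration.integrable_bound[OF sq[of k]]) (use le in auto)
    \<comment> \<open>Only squares are known to be integrable; the product is dominated through
      \<open>2 |u| |v| <= u^2 + v^2\<close>.\<close>
    have i3: "integrable M (\<lambda>\<omega>. (S' k \<omega> * B k \<omega>) * D k \<omega>)"
    proof (rule Bochner_Integration.integrable_bound[OF Bochner_Integration.integrable_add[OF i1 i2]])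
      show "AE \<omega> in M. norm (S' k \<omega> * B k \<omega> * D k \<omega>) \<le> norm ((S' k \<omega>)\<^sup>2 + (B k \<omega> * D k \<omega>)\<^sup>2)"
      proof (rule AE_I2)
        fix \<omega>
        have "2 * \<bar>S' k \<omega>\<bar> * \<bar>B k \<omega> * D k \<omega>\<bar> \<le> (S' k \<omega>)\<^sup>2 + (B k \<omega> * D k \<omega>)\<^sup>2"
          using sum_squares_bound[of "\<bar>S' k \<omega>\<bar>" "\<bar>B k \<omega> * D k \<omega>\<bar>"] by simp
        moreover have "0 \<le> \<bar>S' k \<omega>\<bar> * \<bar>B k \<omega> * D k \<omega>\<bar>" by simp
        ultimately have "\<bar>S' k \<omega>\<bar> * \<bar>B k \<omega> * D k \<omega>\<bar> \<le> (S' k \<omega>)\<^sup>2 + (B k \<omega> * D k \<omega>)\<^sup>2"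
          by linarith
        then show "norm (S' k \<omega> * B k \<omega> * D k \<omega>) \<le> norm ((S' k \<omega>)\<^sup>2 + (B k \<omega> * D k \<omega>)\<^sup>2)"
          by (simp add: abs_mult mult.assoc)
      qed
    qed measurable
    have z: "expectation (\<lambda>\<omega>. (S' k \<omega> * B k \<omega>) * D k \<omega>) = 0"
      using i3 by (intro orth borel_measurable_times S'_G B_G) auto
    have "expectation (\<lambda>\<omega>. (S' (Suc k) \<omega>)\<^sup>2) =
        expectation (\<lambda>\<omega>. (S' k \<omega>)\<^sup>2) + expectation (\<lambda>\<omega>. (B k \<omega> * D k \<omega>)\<^sup>2)"
      unfolding eq using i1 i2 i3 z by simp
    moreover have "expectation (\<lambda>\<omega>. (B k \<omega> * D k \<omega>)\<^sup>2) \<le> expectation (\<lambda>\<omega>. (D k \<omega>)\<^sup>2)"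
      using i2 sq le by (intro integral_mono) auto
    moreover have "integrable M (\<lambda>\<omega>. (S' (Suc k) \<omega>)\<^sup>2)"
      unfolding eq using i1 i2 i3 by auto
    ultimately show ?case using Suc by simp
  qed
  have S'_eq: "S' k \<omega> = S k \<omega>" if "\<forall>j<k. \<bar>S j \<omega>\<bar> < e" for k \<omega>
    using that unfolding S'_def S_def[of k] by (intro sum.cong) (auto simp: B_def)
  \<comment> \<open>After the first exit the factors \<open>B\<close> vanish, so \<open>S'\<close>
    stays at its exit value up to time \<open>n\<close>.\<close>
  have S'_ge: "e \<le> \<bar>S' n \<omega>\<bar>" if "\<exists>k\<le>n. e \<le> \<bar>S k \<omega>\<bar>" for n \<omega>
    using that
  proof (induction n)
    case 0
    then show ?case using S'_eq[of 0 \<omega>] by auto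
  next
    case (Suc n)
    show ?case
    proof (cases "\<exists>k\<le>n. e \<le> \<bar>S k \<omega>\<bar>")
      case True
      then have "B n \<omega> = 0" by (force simp: B_def)
      with Suc.IH[OF True] show ?thesis by (simp add: S'_def)
    next
      case False
      then have "S' (Suc n) \<omega> = S (Suc n) \<omega>" by (intro S'_eq) (meson less_Suc_eq_le not_le)
      with False Suc.prems show ?thesis by (auto simp: le_Suc_eq)
    qed
  qed
  have "prob {\<omega>\<in>space M. \<exists>k\<le>n. e \<le> \<bar>S k \<omega>\<bar>} \<le> prob {\<omega>\<in>space M. (S' n \<omega>)\<^sup>2 \<ge> e\<^sup>2}"
  proof (rule finite_measure_mono)
    show "{\<omega>\<in>space M. \<exists>k\<le>n. e \<le> \<bar>S k \<omega>\<bar>} \<subseteq> {\<omega>\<in>space M. (S' n \<omega>)\<^sup>2 \<ge> e\<^sup>2}"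
    proof safe
      fix \<omega> k assume "k \<le> n" "e \<le> \<bar>S k \<omega>\<bar>"
      then have "e \<le> \<bar>S' n \<omega>\<bar>" by (intro S'_ge) auto
      then show "e\<^sup>2 \<le> (S' n \<omega>)\<^sup>2" using e by (simp flip: abs_le_square_iff)
    qed
  qed measurable
  also have "\<dots> \<le> expectation (\<lambda>\<omega>. (S' n \<omega>)\<^sup>2) / e\<^sup>2"
    using S' e by (intro integral_Markov_inequality_measure[where A="{}"]) auto
  also have "\<dots> \<le> (\<Sum>i<n. expectation (\<lambda>\<omega>. (D i \<omega>)\<^sup>2)) / e\<^sup>2"
    using S' by (intro divide_right_mono) auto
  finally show ?thesis by (simp add: S_def)
qed

text \<open>The maximal inequality for the increments from index \<open>m\<close> on bounds the
  probability that their partial sums ever leave \<open>]-e, e[\<close> by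
  \<open>tail m / e^2\<close>, which tends to 0. Hence almost surely, for each threshold some
  starting index has no exit, and this is the Cauchy criterion.\<close>

theorem (in prob_space) square_integrable_martingale_summable:
  fixes D :: "nat \<Rightarrow> 'a \<Rightarrow> real" and G :: "nat \<Rightarrow> 'a measure"
  assumes sub: "\<And>j. subalgebra M (G j)"
    and ad: "\<And>i j. i < j \<Longrightarrow> D i \<in> borel_measurable (G j)"
    and sq: "\<And>j. integrable M (\<lambda>\<omega>. (D j \<omega>)\<^sup>2)"
    and orth: "\<And>j X. X \<in> borel_measurable (G j) \<Longrightarrow> integrable M (\<lambda>\<omega>. X \<omega> * D j \<omega>) \<Longrightarrow>
      expectation (\<lambda>\<omega>. X \<omega> * D j \<omega>) = 0"
    and sm: "summable (\<lambda>j. expectation (\<lambda>\<omega>. (D j \<omega>)\<^sup>2))"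
  shows "AE \<omega> in M. summable (\<lambda>j. D j \<omega>)"
proof -
  define V where "V j = expectation (\<lambda>\<omega>. (D j \<omega>)\<^sup>2)" for j
  define tail where "tail m = (\<Sum>i. V (i + m))" for m
  have V0: "V j \<ge> 0" for j by (simp add: V_def)
  have smV: "summable V" using sm by (simp add: V_def[abs_def])
  have tail0: "tail \<longlonglongrightarrow> 0"
    unfolding tail_def using suminf_exist_split2[OF smV] .
  have D_M [measurable]: "D i \<in> borel_measurable M" for i
    using ad[of i "Suc i"] sub measurable_from_subalg by blast
  define A where "A e m n = {\<omega>\<in>space M. \<exists>k\<le>n. e \<le> \<bar>\<Sum>i<k. D (i + m) \<omega>\<bar>}" for e :: real and m n
  have A_M [measurable]: "A e m n \<in> sets M" for e m n
    unfolding A_def by measurable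
  have A_le: "prob (A e m n) \<le> tail m / e\<^sup>2" if "e > 0" for e m n
  proof -
    have "prob (A e m n) \<le> (\<Sum>i<n. V (i + m)) / e\<^sup>2"
      unfolding A_def V_def using sub ad sq orth that
      by (intro martingale_maximal_inequality[where G="\<lambda>j. G (j + m)"]) auto
    also have "\<dots> \<le> tail m / e\<^sup>2"
      unfolding tail_def using smV V0
      by (intro divide_right_mono sum_le_suminf) (auto simp: summable_iff_shift)
    finally show ?thesis .
  qed
  have U_le: "prob (\<Union>n. A e m n) \<le> tail m / e\<^sup>2" if "e > 0" for e m
  proof (rule LIMSEQ_le_const2)
    show "(\<lambda>n. prob (A e m n)) \<longlonglongrightarrow> prob (\<Union>n. A e m n)"
    proof (rule finite_Lim_measure_incseq)
      show "incseq (A e m)" by (rule incseq_SucI) (auto simp: A_def intro: le_SucI)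
    qed (auto simp: A_def)
    show "\<exists>N. \<forall>n\<ge>N. prob (A e m n) \<le> tail m / e\<^sup>2" using A_le that by auto
  qed
  \<comment> \<open>The bad event is an exit for every starting index \<open>m\<close>; it lies in
    the exit event of each single \<open>m\<close>, so its probability is at most the limit of
    \<open>tail m / e^2\<close>.\<close>
  have null: "AE \<omega> in M. \<exists>m. \<omega> \<notin> (\<Union>n. A e m n)" if "e > 0" for e
  proof (rule AE_I)
    let ?N = "\<Inter>m. \<Union>n. A e m n"
    show "{\<omega>\<in>space M. \<not> (\<exists>m. \<omega> \<notin> (\<Union>n. A e m n))} \<subseteq> ?N" by auto
    show N: "?N \<in> sets M" by measurable
    have "prob ?N \<le> 0"
    proof (rule LIMSEQ_le_const)
      have "(\<lambda>m. tail m / e\<^sup>2) \<longlonglongrightarrow> 0 / e\<^sup>2" using tail0 that by (intro tendsto_intros) auto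
      then show "(\<lambda>m. tail m / e\<^sup>2) \<longlonglongrightarrow> 0" by simp
      have "prob ?N \<le> tail m / e\<^sup>2" for m
      proof -
        have "prob ?N \<le> prob (\<Union>n. A e m n)" by (rule finite_measure_mono) auto
        then show ?thesis using U_le[OF that, of m] by simp
      qed
      then show "\<exists>N. \<forall>m\<ge>N. prob ?N \<le> tail m / e\<^sup>2" by auto
    qed
    then show "emeasure M ?N = 0" by (simp add: emeasure_eq_measure measure_le_0_iff)
  qed
  have "AE \<omega> in M. \<forall>l::nat. \<exists>m. \<omega> \<notin> (\<Union>n. A (1 / Suc l) m n)"
    using null by (intro AE_all_countable[THEN iffD2]) auto
  with AE_space show ?thesis
  proof eventually_elim
    case (elim \<omega>)
    show ?case
      unfolding summable_Cauchy
    proof (intro allI impI)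
      fix e :: real assume "e > 0"
      \<comment> \<open>Half of \<open>e\<close>, because a block \<open>{q..<n}\<close> is the
        difference of two blocks that start at \<open>m\<close>.\<close>
      then obtain l :: nat where l: "1 / Suc l < e / 2"
        using nat_approx_posE[of "e/2"] by auto
      from elim obtain m where m: "\<omega> \<notin> (\<Union>n. A (1 / Suc l) m n)" by blast
      have b: "\<bar>\<Sum>i<k. D (i + m) \<omega>\<bar> < 1 / Suc l" for k
        using m elim(1) by (auto simp: A_def not_le)
      have eq: "sum (\<lambda>j. D j \<omega>) {m..<m+k} = (\<Sum>i<k. D (i + m) \<omega>)" for k
        using sum.shift_bounds_nat_ivl[of "\<lambda>j. D j \<omega>" 0 m k] by (simp add: atLeast0LessThan add.commute)
      show "\<exists>N. \<forall>q\<ge>N. \<forall>n. norm (sum (\<lambda>j. D j \<omega>) {q..<n}) < e"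
      proof (intro exI allI impI)
        fix q n assume q: "m \<le> q"
        show "norm (sum (\<lambda>j. D j \<omega>) {q..<n}) < e"
        proof (cases "q \<le> n")
          case True
          have "sum (\<lambda>j. D j \<omega>) {m..<n} = sum (\<lambda>j. D j \<omega>) {m..<q} + sum (\<lambda>j. D j \<omega>) {q..<n}"
            using q True by (simp add: sum.atLeastLessThan_concat)
          moreover have "\<bar>sum (\<lambda>j. D j \<omega>) {m..<n}\<bar> < 1 / Suc l" "\<bar>sum (\<lambda>j. D j \<omega>) {m..<q}\<bar> < 1 / Suc l"
            using eq[of "n - m"] eq[of "q - m"] b[of "n - m"] b[of "q - m"] q True by auto
          ultimately show ?thesis using l by (auto simp: abs_less_iff)
        qed (use \<open>e > 0\<close> in auto)
      qed
    qed
  qed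
qed

section \<open>Deterministic descent with noise\<close>

text \<open>If \<open>g\<close> stayed away from zero near a limit point \<open>X\<close>, the path length after a close visit to
  \<open>X\<close> would be controlled by the finite energy dissipation \<open>\<Sum> \<alpha> |g|\<^sup>2\<close>; the path would be trapped
  near \<open>X\<close>, contradicting \<open>\<Sum> \<alpha> = \<infinity>\<close>.\<close>

lemma limit_point_small_gradient:
  fixes y g \<xi> :: "nat \<Rightarrow> 'a::real_normed_vector"
  assumes alpha: "\<And>t. \<alpha> t \<ge> 0" "filterlim (\<lambda>T. \<Sum>t<T. \<alpha> t) at_top sequentially"
    and step: "\<And>t. y (Suc t) = y t - \<alpha> t *\<^sub>R g t + \<alpha> t *\<^sub>R \<xi> t"
    and noise: "summable (\<lambda>t. \<alpha> t *\<^sub>R \<xi> t)"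
    and diss: "summable (\<lambda>t. \<alpha> t * (norm (g t))\<^sup>2)"
    and lim: "strict_mono r" "(\<lambda>k. y (r k)) \<longlonglongrightarrow> X"
    and pos: "\<rho> > 0" "\<delta> > 0"
  shows "\<exists>t. dist (y t) X < \<rho> \<and> norm (g t) < \<delta>"
proof (rule ccontr)
  assume "\<not> ?thesis"
  then have g: "norm (g t) \<ge> \<delta>" if "dist (y t) X < \<rho>" for t
    using that by force
  have conv: "convergent (\<lambda>T. \<Sum>t<T. \<alpha> t *\<^sub>R \<xi> t)" "convergent (\<lambda>T. \<Sum>t<T. \<alpha> t * (norm (g t))\<^sup>2)"
    using noise diss by (simp_all add: summable_iff_convergent)
  obtain N1 where N1: "\<And>m n. m \<ge> N1 \<Longrightarrow> n \<ge> N1 \<Longrightarrow>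
      norm ((\<Sum>t<m. \<alpha> t *\<^sub>R \<xi> t) - (\<Sum>t<n. \<alpha> t *\<^sub>R \<xi> t)) < \<rho> / 4"
    using CauchyD[OF convergent_Cauchy[OF conv(1)], of "\<rho>/4"] pos by auto
  obtain N2 where N2: "\<And>m n. m \<ge> N2 \<Longrightarrow> n \<ge> N2 \<Longrightarrow>
      norm ((\<Sum>t<m. \<alpha> t * (norm (g t))\<^sup>2) - (\<Sum>t<n. \<alpha> t * (norm (g t))\<^sup>2)) < \<delta> * (\<rho> / 4)"
    using CauchyD[OF convergent_Cauchy[OF conv(2)], of "\<delta> * (\<rho>/4)"] pos by auto
  obtain K where K: "\<And>k. k \<ge> K \<Longrightarrow> dist (y (r k)) X < \<rho> / 4"
    using metric_LIMSEQ_D[OF lim(2), of "\<rho>/4"] pos by auto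
  \<comment> \<open>A visit to \<open>X\<close> so late that the remaining noise and dissipation are
    small. The visit, the noise and the path length contribute less than \<open>\<rho> / 4\<close>
    each.\<close>
  define s where "s = r (max K (max N1 N2))"
  have s: "s \<ge> N1" "s \<ge> N2" "dist (y s) X < \<rho> / 4"
    using seq_suble[OF lim(1), of "max K (max N1 N2)"] K[of "max K (max N1 N2)"] by (auto simp: s_def)
  have path: "y (s + k) - y s = (\<Sum>t=s..<s+k. \<alpha> t *\<^sub>R \<xi> t) - (\<Sum>t=s..<s+k. \<alpha> t *\<^sub>R g t)" for k
    by (induction k) (simp_all add: step algebra_simps)
  have tail: "(\<Sum>t<s+k. f t) - (\<Sum>t<s. f t) = (\<Sum>t=s..<s+k. f t)" for f :: "nat \<Rightarrow> 'b::ab_group_add" and k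
    using sum_diff_nat_ivl[of 0 s "s+k" f] by (simp add: atLeast0LessThan)
  \<comment> \<open>Strong induction: as long as the path was in the ball,
    \<open>|g| >= \<delta>\<close> bounds each length \<open>\<alpha> |g|\<close> by
    \<open>\<alpha> |g|^2 / \<delta>\<close>, so the dissipation controls the path length.\<close>
  have near: "dist (y (s + k)) X < \<rho>" for k
  proof (induction k rule: less_induct)
    case (less k)
    have "norm (\<Sum>t=s..<s+k. \<alpha> t *\<^sub>R g t) \<le> (\<Sum>t=s..<s+k. \<alpha> t * norm (g t))"
      by (rule sum_norm_le) (simp add: alpha)
    also have "\<dots> \<le> (\<Sum>t=s..<s+k. \<alpha> t * (norm (g t))\<^sup>2 / \<delta>)"
    proof (rule sum_mono)
      fix t assume t: "t \<in> {s..<s+k}"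
      then have "\<delta> \<le> norm (g t)" using less.IH[of "t - s"] by (intro g) auto
      then have "\<alpha> t * (norm (g t) * \<delta>) \<le> \<alpha> t * (norm (g t) * norm (g t))"
        by (intro mult_left_mono alpha) auto
      then show "\<alpha> t * norm (g t) \<le> \<alpha> t * (norm (g t))\<^sup>2 / \<delta>"
        using pos by (simp add: field_simps power2_eq_square)
    qed
    also have "\<dots> = ((\<Sum>t<s+k. \<alpha> t * (norm (g t))\<^sup>2) - (\<Sum>t<s. \<alpha> t * (norm (g t))\<^sup>2)) / \<delta>"
      by (simp add: tail sum_divide_distrib)
    also have "\<dots> < \<rho> / 4"
    proof -
      have "(\<Sum>t<s+k. \<alpha> t * (norm (g t))\<^sup>2) - (\<Sum>t<s. \<alpha> t * (norm (g t))\<^sup>2) < \<delta> * (\<rho> / 4)"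
        using N2[of "s+k" s] s unfolding real_norm_def abs_less_iff by linarith
      then show ?thesis using pos by (simp add: divide_less_eq mult.commute)
    qed
    finally have "norm (\<Sum>t=s..<s+k. \<alpha> t *\<^sub>R g t) < \<rho> / 4" .
    moreover have "norm (\<Sum>t=s..<s+k. \<alpha> t *\<^sub>R \<xi> t) < \<rho> / 4"
      using N1[of "s+k" s] s by (simp add: tail)
    ultimately have "dist (y (s + k)) (y s) < \<rho> / 2"
      unfolding dist_norm path
      using norm_triangle_ineq4[of "\<Sum>t=s..<s+k. \<alpha> t *\<^sub>R \<xi> t" "\<Sum>t=s..<s+k. \<alpha> t *\<^sub>R g t"] by linarith
    then show ?case using s(3) dist_triangle[of "y (s+k)" X "y s"] pos by simp
  qed
  \<comment> \<open>A trapped path dissipates at least \<open>\<alpha> t \<delta>^2\<close> at every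
    late step, which would make the step sizes summable.\<close>
  have "summable (\<lambda>t. \<alpha> t * \<delta>\<^sup>2)"
  proof (rule summable_comparison_test'[OF diss, of s])
    fix t assume "t \<ge> s"
    then have "\<delta> \<le> norm (g t)" using near[of "t - s"] by (intro g) auto
    then show "norm (\<alpha> t * \<delta>\<^sup>2) \<le> \<alpha> t * (norm (g t))\<^sup>2"
      using alpha(1)[of t] pos by (simp add: mult_left_mono power_mono)
  qed
  then have "summable (\<lambda>t. \<alpha> t * \<delta>\<^sup>2 * (1 / \<delta>\<^sup>2))" by (rule summable_mult2)
  then have "summable \<alpha>" using pos by simp
  then have "(\<lambda>T. \<Sum>t<T. \<alpha> t) \<longlonglongrightarrow> suminf \<alpha>" by (rule summable_LIMSEQ)
  then show False
    using not_tendsto_and_filterlim_at_infinity[OF trivial_limit_sequentially _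
      filterlim_at_top_imp_at_infinity[OF alpha(2)]] by blast
qed

text \<open>A deterministic form of the Robbins-Siegmund argument: minus the partial sums of
  \<open>b\<close> and \<open>c\<close>, the sequence \<open>u\<close> is decreasing and bounded
  below, and its total decrease bounds the sum of \<open>h\<close>.\<close>

lemma noisy_descent_convergent:
  fixes u b c h :: "nat \<Rightarrow> real"
  assumes le: "\<And>t. u (Suc t) \<le> u t - h t + b t + c t"
    and u: "\<And>t. u t \<ge> 0" and h: "\<And>t. h t \<ge> 0" and c: "\<And>t. c t \<ge> 0"
    and b: "summable b" and sc: "summable c"
  shows "convergent u" "summable h"
proof -
  define w where "w t = u t - (\<Sum>s<t. b s) - (\<Sum>s<t. c s)" for t
  have B: "convergent (\<lambda>t. \<Sum>s<t. b s)" and C: "convergent (\<lambda>t. \<Sum>s<t. c s)"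
    using b sc by (simp_all add: summable_iff_convergent)
  obtain Kb where Kb: "\<And>t. \<bar>\<Sum>s<t. b s\<bar> \<le> Kb"
    using Bseq_def[THEN iffD1, OF convergent_imp_Bseq[OF B]] by auto
  obtain Kc where Kc: "\<And>t. \<bar>\<Sum>s<t. c s\<bar> \<le> Kc"
    using Bseq_def[THEN iffD1, OF convergent_imp_Bseq[OF C]] by auto
  have w_step: "w (Suc t) \<le> w t - h t" for t using le[of t] by (simp add: w_def)
  have w_lb: "w t \<ge> - Kb - Kc" for t
    using Kb[of t] Kc[of t] u[of t] unfolding w_def by linarith
  have "decseq w" using w_step h by (intro decseq_SucI) (smt (verit))
  then obtain L where "w \<longlonglongrightarrow> L" using decseq_convergent w_lb by metis
  then have "convergent (\<lambda>t. w t + (\<Sum>s<t. b s) + (\<Sum>s<t. c s))"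
    using B C by (intro convergent_add) (auto simp: convergent_def)
  then show "convergent u" by (simp add: w_def)
  have "(\<Sum>s<t. h s) \<le> w 0 - w t" for t
  proof (induction t)
    case (Suc t)
    then show ?case using w_step[of t] by simp
  qed simp
  note dissipated = this
  have "(\<Sum>s\<le>t. h s) \<le> w 0 + Kb + Kc" for t
  proof -
    have "(\<Sum>s<Suc t. h s) \<le> w 0 - w (Suc t)" by (rule dissipated)
    then show ?thesis using w_lb[of "Suc t"] unfolding lessThan_Suc_atMost by linarith
  qed
  then show "summable h" using h by (intro bounded_imp_summable[where B="w 0 + Kb + Kc"])
qed

section \<open>Optimal transport on the line\<close>

text \<open>Such a \<open>u\<close> and \<open>x j * y j - u j\<close> are Kantorovich potentials for the cost \<open>- x * y\<close>, tight
  on the monotone matching.\<close>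

lemma dual_potential_exists:
  fixes x y :: "'n::linorder \<Rightarrow> real"
  assumes "finite S" "mono_on S x" "mono_on S y"
  shows "\<exists>u. \<forall>i\<in>S. \<forall>j\<in>S. y j * (x i - x j) \<le> u i - u j"
  using assms
proof (induction S rule: finite_linorder_max_induct)
  case empty
  then show ?case by simp
next
  case (insert b S)
  then obtain u where u: "\<And>i j. i \<in> S \<Longrightarrow> j \<in> S \<Longrightarrow> y j * (x i - x j) \<le> u i - u j"
    by (meson mono_on_subset subset_insertI)
  have xb: "x j \<le> x b" and yb: "y j \<le> y b" if "j \<in> S" for j
    using that insert by (auto simp: mono_on_def less_imp_le)
  show ?case
  proof (cases "S = {}")
    case True
    then show ?thesis by (intro exI[of _ "\<lambda>_. 0"]) auto
  next
    case False
    \<comment> \<open>The least value satisfying the constraints with \<open>i = b\<close>. Those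
      with \<open>j = b\<close> then hold because \<open>x b\<close> and \<open>y b\<close> are the
      largest values.\<close>
    define ub where "ub = Max ((\<lambda>j. u j + y j * (x b - x j)) ` S)"
    have lower: "u j + y j * (x b - x j) \<le> ub" if "j \<in> S" for j
      unfolding ub_def using that insert by (intro Max_ge) auto
    have upper: "ub \<le> u j + y b * (x b - x j)" if j: "j \<in> S" for j
    proof -
      have "ub \<in> (\<lambda>j. u j + y j * (x b - x j)) ` S"
        unfolding ub_def using False insert by (intro Max_in) auto
      then obtain k where k: "k \<in> S" "ub = u k + y k * (x b - x k)" by auto
      have "ub \<le> u j + y k * (x b - x j)"
        using u[OF j k(1)] k(2) by (simp add: algebra_simps)
      also have "\<dots> \<le> u j + y b * (x b - x j)"
        using xb[OF j] yb[OF k(1)] by (intro add_left_mono mult_right_mono) auto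
      finally show ?thesis .
    qed
    have "b \<notin> S" using insert by auto
    then have "\<forall>i\<in>insert b S. \<forall>j\<in>insert b S. y j * (x i - x j) \<le> (u(b := ub)) i - (u(b := ub)) j"
      using u lower upper by (auto simp: algebra_simps split: if_splits)
    then show ?thesis by blast
  qed
qed

section \<open>Empirical measures and integrals against them\<close>

lemma prob_space_empirical_measure:
  assumes "finite I" "I \<noteq> {}"
  shows "prob_space (empirical_measure I x)"
proof -
  interpret prob_space "uniform_count_measure I"
    using assms by (rule prob_space_uniform_count_measure)
  show ?thesis
    unfolding empirical_measure_def by (rule prob_space_distr) (simp add: measurable_def sets_uniform_count_measure space_uniform_count_measure)
qed

lemma sets_empirical_measure [simp, measurable_cong]: "sets (empirical_measure I x) = sets borel"
  by (simp add: empirical_measure_def)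

lemma space_empirical_measure [simp]: "space (empirical_measure I x) = UNIV"
  by (simp add: empirical_measure_def)

lemma measurable_uniform_count_measure [simp]: "f \<in> uniform_count_measure I \<rightarrow>\<^sub>M N \<longleftrightarrow> f \<in> I \<rightarrow> space N"
  by (auto simp: measurable_def sets_uniform_count_measure space_uniform_count_measure)

lemma AE_empirical_measure:
  fixes x :: "'i \<Rightarrow> 'a::t1_space"
  assumes "finite I"
  shows "AE z in empirical_measure I x. z \<in> x ` I"
  unfolding empirical_measure_def using assms
  by (subst AE_distr_iff) (auto simp: finite_imp_closed space_uniform_count_measure intro!: borel_closed AE_I2)

lemma integral_empirical_measure:
  fixes f :: "'a::topological_space \<Rightarrow> real"
  assumes "finite I" "f \<in> borel_measurable borel"
  shows "(\<integral>z. f z \<partial>empirical_measure I x) = (\<Sum>i\<in>I. f (x i)) / card I"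
  unfolding empirical_measure_def using assms
  by (subst integral_distr) (auto simp: integral_uniform_count_measure)

lemma distr_empirical_measure:
  assumes "f \<in> borel_measurable borel"
  shows "distr (empirical_measure I x) borel f = empirical_measure I (\<lambda>i. f (x i))"
  unfolding empirical_measure_def using assms by (subst distr_distr) (auto simp: comp_def)

lemma empirical_measure_reindex:
  fixes x :: "'n::finite \<Rightarrow> 'a::topological_space" and \<sigma> :: "'n \<Rightarrow> 'n"
  assumes "bij \<sigma>"
  shows "empirical_measure UNIV (\<lambda>i. x (\<sigma> i)) = empirical_measure UNIV x"
proof (rule measure_eqI)
  fix A assume "A \<in> sets (empirical_measure UNIV (\<lambda>i. x (\<sigma> i)))"
  then have A: "A \<in> sets borel" by simp
  have "(\<Sum>i\<in>UNIV. indicator A (x (\<sigma> i))) = (\<Sum>i\<in>UNIV. indicat_real A (x i))"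
    using assms by (rule sum.reindex_bij_betw)
  then show "emeasure (empirical_measure UNIV (\<lambda>i. x (\<sigma> i))) A = emeasure (empirical_measure UNIV x) A"
    unfolding emeasure_empirical_measure[OF finite UNIV_not_empty A] by simp
qed simp

text \<open>The right-hand side sees only the positive part of \<open>f\<close>. This lets a dual
  functional, which may be negative, bound a transport cost from below.\<close>

lemma integral_le_nn_integral:
  fixes f :: "'a \<Rightarrow> real"
  assumes "integrable M f"
  shows "ennreal (\<integral>w. f w \<partial>M) \<le> (\<integral>\<^sup>+w. ennreal (f w) \<partial>M)"
proof -
  have i: "integrable M (\<lambda>w. max 0 (f w))" using assms by (intro integrable_max) auto
  have "ennreal (\<integral>w. f w \<partial>M) \<le> ennreal (\<integral>w. max 0 (f w) \<partial>M)"
    using assms i by (intro ennreal_leI integral_mono) auto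
  also have "\<dots> = (\<integral>\<^sup>+w. ennreal (f w) \<partial>M)"
    using i by (subst nn_integral_eq_integral[symmetric]) (auto intro!: nn_integral_cong simp: max_def ennreal_neg)
  finally show ?thesis .
qed

lemma wasserstein2_power2:
  "(wasserstein2 M N)\<^sup>2 = enn2real (INF \<pi>\<in>couplings M N. \<integral>\<^sup>+z. ennreal ((dist (fst z) (snd z))\<^sup>2) \<partial>\<pi>)"
  by (simp add: wasserstein2_def)

section \<open>Transport cost of matchings, upper bound and duality\<close>

definition matching_cost :: "('n::finite \<Rightarrow> real) \<Rightarrow> ('n \<Rightarrow> real) \<Rightarrow> ('n \<Rightarrow> 'n) \<Rightarrow> real" where
  "matching_cost x z \<sigma> = (\<Sum>k\<in>UNIV. (x k - z (\<sigma> k))\<^sup>2) / CARD('n)"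

text \<open>A permutation induces the coupling with mass \<open>1/n\<close> at each
  \<open>(x k, z (\<sigma> k))\<close>; its second marginal is correct because reindexing does not
  change an empirical measure.\<close>

lemma INF_couplings_le_matching_cost:
  fixes x z :: "'n::finite \<Rightarrow> real"
  assumes "bij \<sigma>"
  shows "(INF \<pi>\<in>couplings (empirical_measure UNIV x) (empirical_measure UNIV z).
    \<integral>\<^sup>+w. ennreal ((dist (fst w) (snd w))\<^sup>2) \<partial>\<pi>) \<le> ennreal (matching_cost x z \<sigma>)"
proof -
  define \<pi> where "\<pi> = distr (uniform_count_measure UNIV) (borel \<Otimes>\<^sub>M borel) (\<lambda>k. (x k, z (\<sigma> k)))"
  have s: "sets \<pi> = sets (empirical_measure UNIV x \<Otimes>\<^sub>M empirical_measure UNIV z)"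
    unfolding \<pi>_def by (simp cong: sets_pair_measure_cong)
  have "distr \<pi> (empirical_measure UNIV x) fst = distr \<pi> borel fst"
    "distr \<pi> (empirical_measure UNIV z) snd = distr \<pi> borel snd"
    by (intro distr_cong; simp)+
  moreover have "distr \<pi> borel fst = empirical_measure UNIV x" "distr \<pi> borel snd = empirical_measure UNIV (\<lambda>k. z (\<sigma> k))"
    unfolding \<pi>_def empirical_measure_def by (subst distr_distr; simp add: space_pair_measure comp_def)+
  ultimately have "\<pi> \<in> couplings (empirical_measure UNIV x) (empirical_measure UNIV z)"
    using s empirical_measure_reindex[OF assms, of z] by (simp add: couplings_def)
  then have "(INF \<pi>\<in>couplings (empirical_measure UNIV x) (empirical_measure UNIV z).
      \<integral>\<^sup>+w. ennreal ((dist (fst w) (snd w))\<^sup>2) \<partial>\<pi>) \<le> (\<integral>\<^sup>+w. ennreal ((dist (fst w) (snd w))\<^sup>2) \<partial>\<pi>)"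
    by (rule INF_lower)
  also have "\<dots> = (\<integral>\<^sup>+k. ennreal ((x k - z (\<sigma> k))\<^sup>2) \<partial>uniform_count_measure UNIV)"
    unfolding \<pi>_def by (subst nn_integral_distr) (auto simp: space_pair_measure dist_real_def)
  also have "\<dots> = (\<Sum>k\<in>UNIV. ennreal ((x k - z (\<sigma> k))\<^sup>2) * ennreal (1 / CARD('n)))"
    unfolding uniform_count_measure_def by (subst nn_integral_point_measure_finite) (auto simp: mult.commute)
  also have "\<dots> = ennreal (matching_cost x z \<sigma>)"
    by (simp add: matching_cost_def ennreal_mult[symmetric] sum_ennreal sum_divide_distrib sum_nonneg)
  finally show ?thesis .
qed

lemma wasserstein2_le_matching_cost:
  fixes x z :: "'n::finite \<Rightarrow> real"
  assumes "bij \<sigma>"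
  shows "(wasserstein2 (empirical_measure UNIV x) (empirical_measure UNIV z))\<^sup>2 \<le> matching_cost x z \<sigma>"
proof -
  have "matching_cost x z \<sigma> \<ge> 0" by (simp add: matching_cost_def sum_nonneg)
  then show ?thesis
    unfolding wasserstein2_power2 using INF_couplings_le_matching_cost[OF assms]
    by (metis enn2real_ennreal enn2real_mono ennreal_less_top)
qed

text \<open>The dual potentials are extended to the whole line by Legendre transforms.\<close>

lemma INF_couplings_ge_matching_cost:
  fixes \<tau> \<rho> :: "'n::{finite,linorder} \<Rightarrow> 'n" and x z :: "'n \<Rightarrow> real"
  assumes \<tau>: "bij \<tau>" "mono (\<lambda>i. x (\<tau> i))" and \<rho>: "bij \<rho>" "mono (\<lambda>i. z (\<rho> i))"
  shows "ennreal (matching_cost x z (\<rho> \<circ> inv \<tau>)) \<le>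
    (INF \<pi>\<in>couplings (empirical_measure UNIV x) (empirical_measure UNIV z).
      \<integral>\<^sup>+w. ennreal ((dist (fst w) (snd w))\<^sup>2) \<partial>\<pi>)"
proof (rule INF_greatest)
  fix \<pi> assume "\<pi> \<in> couplings (empirical_measure UNIV x) (empirical_measure UNIV z)"
  then have s: "sets \<pi> = sets (empirical_measure UNIV x \<Otimes>\<^sub>M empirical_measure UNIV z)"
    and d1: "distr \<pi> (empirical_measure UNIV x) fst = empirical_measure UNIV x"
    and d2: "distr \<pi> (empirical_measure UNIV z) snd = empirical_measure UNIV z"
    by (auto simp: couplings_def)
  have s' [measurable_cong]: "sets \<pi> = sets (borel \<Otimes>\<^sub>M borel)"
    unfolding s by (intro sets_pair_measure_cong) auto
  have fst': "fst \<in> \<pi> \<rightarrow>\<^sub>M empirical_measure UNIV x" and snd': "snd \<in> \<pi> \<rightarrow>\<^sub>M empirical_measure UNIV z"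
    by measurable
  interpret X: prob_space "empirical_measure UNIV x" by (rule prob_space_empirical_measure) auto
  interpret prob_space \<pi>
    by (rule prob_space_distrD[OF fst']) (simp add: d1 X.prob_space_axioms)
  define x' z' where "x' i = x (\<tau> i)" and "z' i = z (\<rho> i)" for i
  obtain u where u: "\<And>i j. z' j * (x' i - x' j) \<le> u i - u j"
    using dual_potential_exists[OF finite \<tau>(2) \<rho>(2)] by (auto simp: x'_def z'_def)
  \<comment> \<open>The value making the dual constraint an equality on the sorted pairs
    \<open>(x' j, z' j)\<close>.\<close>
  define v where "v j = x' j * z' j - u j" for j
  define f where "f s = Max ((\<lambda>j. z' j * s - v j) ` UNIV)" for s
  define h where "h s = Max ((\<lambda>i. x' i * s - u i) ` UNIV)" for s
  have [measurable]: "f \<in> borel_measurable borel" "h \<in> borel_measurable borel"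
    unfolding f_def[abs_def] h_def[abs_def] by (intro borel_measurable_Max; simp)+
  have uv: "z' j * x' i - v j \<le> u i" for i j
    using u[of j i] by (simp add: v_def algebra_simps)
  have f: "f (x' i) = u i" for i
    unfolding f_def
  proof (intro Max_eqI)
    show "u i \<in> range (\<lambda>j. z' j * x' i - v j)" by (rule image_eqI[of _ _ i]) (auto simp: v_def)
  qed (use uv in auto)
  have h: "h (z' j) = v j" for j
    unfolding h_def
  proof (intro Max_eqI)
    show "v j \<in> range (\<lambda>i. x' i * z' j - u i)" by (rule image_eqI[of _ _ j]) (auto simp: v_def)
    fix y assume "y \<in> range (\<lambda>i. x' i * z' j - u i)"
    then show "y \<le> v j" using uv[of j] by (auto simp: algebra_simps)
  qed auto
  \<comment> \<open>The first argument is an atom, where \<open>f\<close> takes the value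
    \<open>u i\<close>; this suffices because almost every \<open>fst w\<close> is an atom.\<close>
  have fh: "x' i * s \<le> f (x' i) + h s" for i s
  proof -
    have "x' i * s - u i \<le> h s" unfolding h_def by (intro Max_ge) auto
    then show ?thesis by (simp add: f)
  qed
  have range': "range x = range x'" "range z = range z'"
    using image_image[of x \<tau> UNIV] image_image[of z \<rho> UNIV] bij_is_surj[OF \<tau>(1)] bij_is_surj[OF \<rho>(1)]
    unfolding x'_def z'_def by simp_all
  have ae1: "AE w in \<pi>. fst w \<in> range x'"
  proof -
    have "AE s in distr \<pi> (empirical_measure UNIV x) fst. s \<in> range x'"
      unfolding d1 range'(1)[symmetric] by (rule AE_empirical_measure) simp
    from AE_distrD[OF fst' this] show ?thesis .
  qed
  have ae2: "AE w in \<pi>. snd w \<in> range z'"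
  proof -
    have "AE s in distr \<pi> (empirical_measure UNIV z) snd. s \<in> range z'"
      unfolding d2 range'(2)[symmetric] by (rule AE_empirical_measure) simp
    from AE_distrD[OF snd' this] show ?thesis .
  qed
  have int1: "integrable \<pi> (\<lambda>w. k (fst w))" if [measurable]: "k \<in> borel_measurable borel" for k :: "real \<Rightarrow> real"
  proof (rule integrable_const_bound)
    show "AE w in \<pi>. norm (k (fst w)) \<le> Max (range (\<lambda>i. norm (k (x' i))))"
      using ae1 by eventually_elim (auto intro!: Max_ge)
  qed measurable
  have int2: "integrable \<pi> (\<lambda>w. k (snd w))" if [measurable]: "k \<in> borel_measurable borel" for k :: "real \<Rightarrow> real"
  proof (rule integrable_const_bound)
    show "AE w in \<pi>. norm (k (snd w)) \<le> Max (range (\<lambda>i. norm (k (z' i))))"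
      using ae2 by eventually_elim (auto intro!: Max_ge)
  qed measurable
  have e1: "expectation (\<lambda>w. k (fst w)) = (\<Sum>i\<in>UNIV. k (x' i)) / CARD('n)"
    if [measurable]: "k \<in> borel_measurable borel" for k :: "real \<Rightarrow> real"
  proof -
    have "expectation (\<lambda>w. k (fst w)) = (\<integral>s. k s \<partial>distr \<pi> (empirical_measure UNIV x) fst)"
      by (rule integral_distr[symmetric, OF fst']) simp
    then show ?thesis
      using integral_empirical_measure[of UNIV k x] sum.reindex_bij_betw[OF \<tau>(1), of "\<lambda>i. k (x i)"]
      by (simp add: d1 x'_def)
  qed
  have e2: "expectation (\<lambda>w. k (snd w)) = (\<Sum>i\<in>UNIV. k (z' i)) / CARD('n)"
    if [measurable]: "k \<in> borel_measurable borel" for k :: "real \<Rightarrow> real"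
  proof -
    have "expectation (\<lambda>w. k (snd w)) = (\<integral>s. k s \<partial>distr \<pi> (empirical_measure UNIV z) snd)"
      by (rule integral_distr[symmetric, OF snd']) simp
    then show ?thesis
      using integral_empirical_measure[of UNIV k z] sum.reindex_bij_betw[OF \<rho>(1), of "\<lambda>i. k (z i)"]
      by (simp add: d2 z'_def)
  qed
  \<comment> \<open>From \<open>(s - t)^2 = s^2 + t^2 - 2 s t\<close>: where
    \<open>s t <= f s + h t\<close>, the sum \<open>q1 s + q2 t\<close> lies below the squared
    distance, with equality on the sorted pairs.\<close>
  define q1 q2 where "q1 s = s\<^sup>2 - 2 * f s" and "q2 s = s\<^sup>2 - 2 * h s" for s :: real
  have [measurable]: "q1 \<in> borel_measurable borel" "q2 \<in> borel_measurable borel"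
    unfolding q1_def[abs_def] q2_def[abs_def] by measurable
  have "matching_cost x z (\<rho> \<circ> inv \<tau>) = (\<Sum>i\<in>UNIV. (x' i - z' i)\<^sup>2) / CARD('n)"
    unfolding matching_cost_def x'_def z'_def using \<tau>(1)
    by (subst sum.reindex_bij_betw[OF \<tau>(1), symmetric]) (simp add: bij_is_inj)
  also have "\<dots> = (\<Sum>i\<in>UNIV. q1 (x' i)) / CARD('n) + (\<Sum>i\<in>UNIV. q2 (z' i)) / CARD('n)"
    unfolding add_divide_distrib[symmetric] sum.distrib[symmetric] q1_def q2_def f h v_def
    by (simp add: power2_eq_square algebra_simps)
  also have "\<dots> = expectation (\<lambda>w. q1 (fst w) + q2 (snd w))"
    using int1[of q1] int2[of q2] by (simp add: e1 e2)
  finally have "ennreal (matching_cost x z (\<rho> \<circ> inv \<tau>)) = ennreal (expectation (\<lambda>w. q1 (fst w) + q2 (snd w)))"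
    by simp
  also have "\<dots> \<le> (\<integral>\<^sup>+w. ennreal (q1 (fst w) + q2 (snd w)) \<partial>\<pi>)"
    using int1[of q1] int2[of q2] by (intro integral_le_nn_integral) auto
  also have "\<dots> \<le> (\<integral>\<^sup>+w. ennreal ((dist (fst w) (snd w))\<^sup>2) \<partial>\<pi>)"
  proof (rule nn_integral_mono_AE)
    show "AE w in \<pi>. ennreal (q1 (fst w) + q2 (snd w)) \<le> ennreal ((dist (fst w) (snd w))\<^sup>2)"
      using ae1
    proof eventually_elim
      case (elim w)
      then obtain i where "fst w = x' i" by auto
      then show ?case
        using fh[of i "snd w"] by (intro ennreal_leI) (simp add: q1_def q2_def dist_real_def power2_diff)
    qed
  qed
  finally show "ennreal (matching_cost x z (\<rho> \<circ> inv \<tau>)) \<le> (\<integral>\<^sup>+w. ennreal ((dist (fst w) (snd w))\<^sup>2) \<partial>\<pi>)" .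
qed

text \<open>The upper and lower bounds meet for any two sorting permutations, so the choice made at
  ties does not affect the cost.\<close>

lemma wasserstein2_eq_sorted_cost:
  fixes \<tau> \<rho> :: "'n::{finite,linorder} \<Rightarrow> 'n" and x z :: "'n \<Rightarrow> real"
  assumes \<tau>: "bij \<tau>" "mono (\<lambda>i. x (\<tau> i))" and \<rho>: "bij \<rho>" "mono (\<lambda>i. z (\<rho> i))"
  shows "(wasserstein2 (empirical_measure UNIV x) (empirical_measure UNIV z))\<^sup>2 = matching_cost x z (\<rho> \<circ> inv \<tau>)"
proof -
  have "bij (\<rho> \<circ> inv \<tau>)" using \<tau> \<rho> by (intro bij_comp bij_imp_bij_inv)
  then have "(INF \<pi>\<in>couplings (empirical_measure UNIV x) (empirical_measure UNIV z).
      \<integral>\<^sup>+w. ennreal ((dist (fst w) (snd w))\<^sup>2) \<partial>\<pi>) = ennreal (matching_cost x z (\<rho> \<circ> inv \<tau>))"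
    using INF_couplings_le_matching_cost INF_couplings_ge_matching_cost[OF assms] by (intro antisym) auto
  then show ?thesis
    unfolding wasserstein2_power2 by (simp add: matching_cost_def sum_nonneg)
qed

section \<open>Sliced energies\<close>

text \<open>The inequality from \<open>x\<close> to \<open>x + h\<close> bounds the first-order
  remainder above by \<open>|h|^2\<close>. The reverse one, from \<open>x + h\<close> to
  \<open>x\<close>, bounds it below with \<open>g (x + h)\<close> in place of \<open>g x\<close>,
  and continuity makes the difference \<open>o(|h|)\<close>.\<close>

lemma gderiv_semiconcave:
  fixes F :: "'a::euclidean_space \<Rightarrow> real"
  assumes descent: "\<And>x y. F y \<le> F x + g x \<bullet> (y - x) + (norm (y - x))\<^sup>2" and cont: "isCont g x"
  shows "GDERIV F x :> g x"
proof -
  have bound: "norm (F (x + h) - F x - h \<bullet> g x) / norm h \<le> norm (g (x + h) - g x) + norm h" for h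
  proof (cases "h = 0")
    case False
    have up: "F (x + h) - F x - h \<bullet> g x \<le> norm h * norm h"
      using descent[of "x + h" x] by (simp add: inner_commute power2_eq_square)
    have "F x \<le> F (x + h) - g (x + h) \<bullet> h + norm h * norm h"
      using descent[of x "x + h"] by (simp add: power2_eq_square)
    moreover have "\<bar>(g (x + h) - g x) \<bullet> h\<bar> \<le> norm (g (x + h) - g x) * norm h"
      by (rule Cauchy_Schwarz_ineq2)
    ultimately have lo: "- (F (x + h) - F x - h \<bullet> g x) \<le> norm (g (x + h) - g x) * norm h + norm h * norm h"
      by (simp add: inner_diff_left inner_diff_right inner_commute)
    have "norm (F (x + h) - F x - h \<bullet> g x) \<le> (norm (g (x + h) - g x) + norm h) * norm h"
      using up lo by (simp add: abs_le_iff distrib_right) (smt (verit) mult_nonneg_nonneg norm_ge_zero)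
    then show ?thesis using False by (simp add: divide_le_eq)
  qed simp
  have "((\<lambda>h. norm (g (x + h) - g x) + norm h) \<longlongrightarrow> norm (g x - g x) + norm (0::'a)) (at 0)"
    using cont by (intro tendsto_intros) (simp add: isCont_iff)
  then have lim: "((\<lambda>h. norm (g (x + h) - g x) + norm h) \<longlongrightarrow> 0) (at 0)" by simp
  have "((\<lambda>h. norm (F (x + h) - F x - h \<bullet> g x) / norm h) \<longlongrightarrow> 0) (at 0)"
    by (rule tendsto_sandwich[OF _ _ tendsto_const lim]) (use bound in \<open>auto intro!: always_eventually\<close>)
  then show ?thesis
    unfolding gderiv_def has_derivative_at by (simp add: bounded_linear_inner_left)
qed

text \<open>The position of \<open>k\<close> in a sorted list without ties is the number of smaller
  entries, and both families of values induce the same strict order.\<close>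

lemma sorting_permutation_unique:
  fixes x x' :: "'n::{finite,linorder} \<Rightarrow> real" and f f' :: "'n \<Rightarrow> 'n"
  assumes f: "bij f" "mono (\<lambda>i. x (f i))" and f': "bij f'" "mono (\<lambda>i. x' (f' i))"
    and inj: "inj x" and less: "\<And>k l. x k < x l \<Longrightarrow> x' k < x' l"
  shows "inv f = inv f'"
proof
  fix k
  have rank: "card {..<i} = card {l. y l < y (h i)}"
    if h: "bij h" "mono (\<lambda>i. y (h i))" and y: "inj y" for h :: "'n \<Rightarrow> 'n" and y :: "'n \<Rightarrow> real" and i
  proof -
    have "h ` {..<i} = {l. y l < y (h i)}"
    proof (intro equalityI subsetI)
      fix l assume "l \<in> h ` {..<i}"
      then obtain j where j: "j < i" "l = h j" by auto
      have "y (h j) \<le> y (h i)" using monoD[OF h(2), of j i] j by simp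
      moreover have "y (h j) \<noteq> y (h i)"
        using j bij_is_inj[OF h(1)] y by (auto dest!: injD)
      ultimately show "l \<in> {l. y l < y (h i)}" using j by auto
    next
      fix l assume "l \<in> {l. y l < y (h i)}"
      moreover obtain j where "l = h j" using bij_is_surj[OF h(1)] by (metis surjD)
      ultimately have "j < i" using monoD[OF h(2), of i j] by (auto simp flip: not_le)
      with \<open>l = h j\<close> show "l \<in> h ` {..<i}" by auto
    qed
    then show ?thesis using h(1) by (metis bij_is_inj card_image inj_on_subset subset_UNIV)
  qed
  have iff: "x' k < x' l \<longleftrightarrow> x k < x l" for k l
    using less[of k l] less[of l k] inj by (metis injD linorder_less_linear order_less_asym order_less_irrefl)
  have inj': "inj x'"
    using inj iff by (metis injD injI linorder_less_linear order_less_irrefl)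
  have "card {..<inv f k} = card {l. x l < x k}"
    using rank[of f x "inv f k"] f inj by (simp add: bij_is_surj surj_f_inv_f)
  moreover have "card {..<inv f' k} = card {l. x' l < x' k}"
    using rank[of f' x' "inv f' k"] f' inj' by (simp add: bij_is_surj surj_f_inv_f)
  ultimately have eq: "card {..<inv f k} = card {..<inv f' k}" by (simp add: iff)
  have "card {..<i} < card {..<j}" if "i < j" for i j :: 'n
    using that by (intro psubset_card_mono) auto
  with eq show "inv f k = inv f' k" by (metis linorder_less_linear order_less_irrefl)
qed

text \<open>A tie between rows \<open>k\<close> and \<open>l\<close> means that \<open>Y\<close>
  lies in the hyperplane orthogonal to the matrix with \<open>\<theta>\<close> in row
  \<open>k\<close>, \<open>- \<theta>\<close> in row \<open>l\<close> and zeros elsewhere.\<close>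

lemma negligible_coinciding_projections:
  fixes \<theta> :: "real^'d"
  assumes "\<theta> \<noteq> 0" "k \<noteq> l"
  shows "AE Y in lborel. \<theta> \<bullet> ((Y :: real^'d^'n) $ k) \<noteq> \<theta> \<bullet> (Y $ l)"
proof -
  define V :: "real^'d^'n" where "V = (\<chi> i. if i = k then \<theta> else if i = l then - \<theta> else 0)"
  have "V $ k = \<theta>" by (simp add: V_def)
  then have "V \<noteq> 0" using assms by auto
  have V: "V \<bullet> Y = \<theta> \<bullet> (Y $ k) - \<theta> \<bullet> (Y $ l)" for Y :: "real^'d^'n"
  proof -
    have "V \<bullet> Y = (\<Sum>i\<in>UNIV. (if i = k then \<theta> \<bullet> (Y $ k) else 0) - (if i = l then \<theta> \<bullet> (Y $ l) else 0))"
      unfolding inner_vec_def[of V Y] unfolding V_def using assms(2) by (intro sum.cong) auto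
    then show ?thesis by (simp add: sum_subtractf)
  qed
  have "negligible {Y. V \<bullet> Y = 0}" using \<open>V \<noteq> 0\<close> by (intro negligible_hyperplane) auto
  then have "AE Y in lebesgue. V \<bullet> Y \<noteq> 0"
    by (intro AE_I'[of "{Y. V \<bullet> Y = 0}"]) (auto simp: negligible_iff_null_sets)
  then have "AE Y in lborel. V \<bullet> Y \<noteq> 0" by (simp add: AE_completion_iff)
  then show ?thesis by (simp add: V)
qed

text \<open>Common frame for the spherical measure and for finitely many directions: a Borel
  probability measure carried by the unit sphere.\<close>

locale sliced_energy =
  fixes Z :: "real^'d^'n::{finite,linorder}"
    and \<tau> :: "real^'d^'n::_ \<Rightarrow> real^'d \<Rightarrow> 'n \<Rightarrow> 'n"
    and \<mu> :: "(real^'d) measure"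
  assumes sorting: "sorting_choice \<tau>"
    and prob_mu: "prob_space \<mu>"
    and sets_mu [measurable_cong]: "sets \<mu> = sets borel"
    and sphere_mu: "AE \<theta> in \<mu>. \<theta> \<in> sphere 0 1"
begin

sublocale mu: prob_space \<mu> by (rule prob_mu)

definition cost :: "real^'d \<Rightarrow> real^'d^'n::_ \<Rightarrow> ('n \<Rightarrow> 'n) \<Rightarrow> real" where
  "cost \<theta> Y = matching_cost (\<lambda>k. \<theta> \<bullet> (Y $ k)) (\<lambda>k. \<theta> \<bullet> (Z $ k))"

definition matching :: "real^'d \<Rightarrow> real^'d^'n::_ \<Rightarrow> 'n \<Rightarrow> 'n" where
  "matching \<theta> Y = \<tau> Z \<theta> \<circ> inv (\<tau> Y \<theta>)"

text \<open>Off the sphere nothing is known about \<open>\<tau>\<close>, not even measurability, hence the value 0.\<close>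

definition slope :: "real^'d^'n::_ \<Rightarrow> real^'d \<Rightarrow> real^'d^'n::_" where
  "slope Y \<theta> = (if \<theta> \<in> sphere 0 1 then phi \<tau> Z Y \<theta> else 0)"

definition mean_slope :: "real^'d^'n::_ \<Rightarrow> real^'d^'n::_" where
  "mean_slope Y = (\<integral>\<theta>. slope Y \<theta> \<partial>\<mu>)"

lemma sliced_w2_sq_eq:
  "sliced_w2_sq Z \<theta> Y = (wasserstein2 (empirical_measure UNIV (\<lambda>k. \<theta> \<bullet> (Y $ k)))
     (empirical_measure UNIV (\<lambda>k. \<theta> \<bullet> (Z $ k))))\<^sup>2"
  by (simp add: sliced_w2_sq_def row_measure_def distr_empirical_measure)

lemma sorting_bij: "\<theta> \<in> sphere 0 1 \<Longrightarrow> bij (\<tau> X \<theta>)"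
  and sorting_mono: "\<theta> \<in> sphere 0 1 \<Longrightarrow> mono (\<lambda>i. \<theta> \<bullet> (X $ \<tau> X \<theta> i))"
  using sorting by (auto simp: sorting_choice_def)

lemma bij_matching: "\<theta> \<in> sphere 0 1 \<Longrightarrow> bij (matching \<theta> Y)"
  unfolding matching_def by (intro bij_comp bij_imp_bij_inv sorting_bij)

lemma sliced_w2_sq_le_cost: "bij \<sigma> \<Longrightarrow> sliced_w2_sq Z \<theta> Y \<le> cost \<theta> Y \<sigma>"
  unfolding sliced_w2_sq_eq cost_def by (rule wasserstein2_le_matching_cost)

lemma sliced_w2_sq_eq_cost: "\<theta> \<in> sphere 0 1 \<Longrightarrow> sliced_w2_sq Z \<theta> Y = cost \<theta> Y (matching \<theta> Y)"
  unfolding sliced_w2_sq_eq cost_def matching_def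
  by (rule wasserstein2_eq_sorted_cost) (simp_all only: sorting_bij sorting_mono)

text \<open>Allowing arbitrary \<open>\<theta>\<close> yields a finite minimum formula on the whole
  space, hence Borel measurability in \<open>\<theta>\<close>. A nonzero \<open>\<theta>\<close> is
  sorted by its normalisation, which differs by a positive factor; for \<open>\<theta> = 0\<close>
  all projections vanish.\<close>

lemma sliced_w2_sq_attained: "\<exists>\<sigma>. bij \<sigma> \<and> sliced_w2_sq Z \<theta> Y = cost \<theta> Y \<sigma>"
proof (cases "\<theta> = 0")
  case True
  have "sliced_w2_sq Z \<theta> Y = cost \<theta> Y (id \<circ> inv id)"
    unfolding sliced_w2_sq_eq cost_def by (rule wasserstein2_eq_sorted_cost) (simp_all add: True mono_def)
  then show ?thesis using bij_id by auto
next
  case False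
  define \<eta> where "\<eta> = \<theta> /\<^sub>R norm \<theta>"
  have \<eta>: "\<eta> \<in> sphere 0 1" "\<theta> = norm \<theta> *\<^sub>R \<eta>" using False by (auto simp: \<eta>_def)
  have mono: "mono (\<lambda>i. \<theta> \<bullet> (X $ \<tau> X \<eta> i))" for X
    using sorting_mono[OF \<eta>(1), of X] by (subst \<eta>(2)) (simp add: mono_def mult_left_mono)
  have "sliced_w2_sq Z \<theta> Y = cost \<theta> Y (\<tau> Z \<eta> \<circ> inv (\<tau> Y \<eta>))"
    unfolding sliced_w2_sq_eq cost_def
    by (rule wasserstein2_eq_sorted_cost) (simp_all only: sorting_bij[OF \<eta>(1)] mono)
  then show ?thesis using bij_matching[OF \<eta>(1), of Y] by (auto simp: matching_def)
qed

lemma sliced_w2_sq_eq_Min: "sliced_w2_sq Z \<theta> Y = Min (cost \<theta> Y ` {\<sigma>. bij \<sigma>})"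
  using sliced_w2_sq_attained[where \<theta>=\<theta> and Y=Y] sliced_w2_sq_le_cost[where \<theta>=\<theta> and Y=Y]
  by (intro Min_eqI[symmetric]) auto

lemma sliced_w2_sq_measurable [measurable]: "(\<lambda>\<theta>. sliced_w2_sq Z \<theta> Y) \<in> borel_measurable borel"
proof -
  have [measurable]: "(\<lambda>\<theta>. cost \<theta> Y \<sigma>) \<in> borel_measurable borel" for \<sigma>
    unfolding cost_def matching_cost_def by measurable
  show ?thesis unfolding sliced_w2_sq_eq_Min by measurable
qed

lemma sliced_w2_sq_nonneg: "sliced_w2_sq Z \<theta> Y \<ge> 0"
  by (simp add: sliced_w2_sq_def)

lemma residual_le:
  assumes "\<theta> \<in> sphere 0 1"
  shows "\<bar>\<theta> \<bullet> (Y $ k - Z $ l)\<bar> \<le> norm Y + norm Z"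
proof -
  have "\<bar>\<theta> \<bullet> (Y $ k - Z $ l)\<bar> \<le> norm \<theta> * norm (Y $ k - Z $ l)" by (rule Cauchy_Schwarz_ineq2)
  also have "\<dots> \<le> norm (Y $ k) + norm (Z $ l)" using assms norm_triangle_ineq4 by simp
  also have "\<dots> \<le> norm Y + norm Z"
    using Finite_Cartesian_Product.norm_nth_le[of Y k] Finite_Cartesian_Product.norm_nth_le[of Z l] by simp
  finally show ?thesis .
qed

lemma sliced_w2_sq_bound:
  assumes "\<theta> \<in> sphere 0 1"
  shows "sliced_w2_sq Z \<theta> Y \<le> (norm Y + norm Z)\<^sup>2"
proof -
  have "(\<Sum>k\<in>UNIV. (\<theta> \<bullet> (Y $ k) - \<theta> \<bullet> (Z $ k))\<^sup>2) \<le> (\<Sum>k\<in>(UNIV::'n set). (norm Y + norm Z)\<^sup>2)"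
    using residual_le[OF assms, of Y]
    by (intro sum_mono abs_le_square_iff[THEN iffD1]) (simp add: inner_diff_right)
  then have "cost \<theta> Y id \<le> (norm Y + norm Z)\<^sup>2"
    by (simp add: cost_def matching_cost_def divide_le_eq mult.commute)
  then show ?thesis using sliced_w2_sq_le_cost[OF bij_id, of \<theta> Y] by simp
qed

text \<open>The factor \<open>1/n\<close> in each row compensates the sum over the \<open>n\<close>
  rows.\<close>

lemma norm_slope_le: "norm (slope Y \<theta>) \<le> 2 * (norm Y + norm Z)"
proof (cases "\<theta> \<in> sphere 0 1")
  case True
  have "norm (slope Y \<theta>) \<le> (\<Sum>k\<in>UNIV. norm (slope Y \<theta> $ k))"
    by (simp add: norm_vec_def L2_set_le_sum)
  also have "\<dots> \<le> (\<Sum>k\<in>(UNIV::'n set). (2 / CARD('n)) * (norm Y + norm Z))"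
  proof (rule sum_mono)
    fix k
    have "norm (slope Y \<theta> $ k) = (2 / CARD('n)) * \<bar>\<theta> \<bullet> (Y $ k - Z $ matching \<theta> Y k)\<bar>"
      using True by (simp add: slope_def phi_def matching_def)
    also have "\<dots> \<le> (2 / CARD('n)) * (norm Y + norm Z)"
      using residual_le[OF True] by (intro mult_left_mono) auto
    finally show "norm (slope Y \<theta> $ k) \<le> (2 / CARD('n)) * (norm Y + norm Z)" .
  qed
  finally show ?thesis by simp
qed (simp add: slope_def)

text \<open>The optimal matching at \<open>Y\<close> is an admissible competitor at
  \<open>Y'\<close>. Its cost is quadratic in \<open>Y'\<close>, touches the transport cost at
  \<open>Y\<close> with gradient \<open>slope Y \<theta>\<close>, and has second-order term at most
  \<open>|Y' - Y|^2\<close> because \<open>\<theta>\<close> is a unit vector.\<close>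

lemma sliced_w2_sq_descent:
  assumes \<theta>: "\<theta> \<in> sphere 0 1"
  shows "sliced_w2_sq Z \<theta> Y' \<le> sliced_w2_sq Z \<theta> Y + slope Y \<theta> \<bullet> (Y' - Y) + (norm (Y' - Y))\<^sup>2"
proof -
  define \<sigma> where "\<sigma> = matching \<theta> Y"
  define r where "r k = \<theta> \<bullet> (Y $ k) - \<theta> \<bullet> (Z $ \<sigma> k)" for k
  define h where "h k = \<theta> \<bullet> (Y' $ k - Y $ k)" for k
  have "sliced_w2_sq Z \<theta> Y' \<le> cost \<theta> Y' \<sigma>"
    unfolding \<sigma>_def using \<theta> by (intro sliced_w2_sq_le_cost bij_matching)
  also have "\<dots> = (\<Sum>k\<in>UNIV. (r k)\<^sup>2 + 2 * (r k * h k) + (h k)\<^sup>2) / CARD('n)"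
    unfolding cost_def matching_cost_def r_def h_def
    by (intro arg_cong2[where f="(/)"] sum.cong refl) (simp add: inner_diff_right power2_eq_square algebra_simps)
  also have "\<dots> = (\<Sum>k\<in>UNIV. (r k)\<^sup>2) / CARD('n) + (\<Sum>k\<in>UNIV. 2 * (r k * h k)) / CARD('n) + (\<Sum>k\<in>UNIV. (h k)\<^sup>2) / CARD('n)"
    by (simp add: sum.distrib add_divide_distrib)
  also have "(\<Sum>k\<in>UNIV. (r k)\<^sup>2) / CARD('n) = sliced_w2_sq Z \<theta> Y"
    unfolding sliced_w2_sq_eq_cost[OF \<theta>] by (simp add: cost_def matching_cost_def r_def \<sigma>_def)
  also have "(\<Sum>k\<in>UNIV. 2 * (r k * h k)) / CARD('n) = slope Y \<theta> \<bullet> (Y' - Y)"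
    unfolding inner_vec_def[of "slope Y \<theta>"] sum_divide_distrib using \<theta>
    by (intro sum.cong) (simp_all add: slope_def phi_def r_def h_def \<sigma>_def matching_def flip: inner_diff_right)
  also have "(\<Sum>k\<in>UNIV. (h k)\<^sup>2) / CARD('n) \<le> (norm (Y' - Y))\<^sup>2"
  proof -
    have "(h k)\<^sup>2 \<le> (Y' - Y) $ k \<bullet> (Y' - Y) $ k" for k
    proof -
      have "\<bar>h k\<bar> \<le> norm \<theta> * norm (Y' $ k - Y $ k)" unfolding h_def by (rule Cauchy_Schwarz_ineq2)
      then have "\<bar>h k\<bar>\<^sup>2 \<le> (norm (Y' $ k - Y $ k))\<^sup>2" using \<theta> by (intro power_mono) simp_all
      then show ?thesis by (simp add: power2_norm_eq_inner)
    qed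
    then have "(\<Sum>k\<in>UNIV. (h k)\<^sup>2) \<le> (norm (Y' - Y))\<^sup>2"
      unfolding power2_norm_eq_inner by (subst inner_vec_def) (intro sum_mono)
    moreover have "(\<Sum>k\<in>UNIV. (h k)\<^sup>2) / CARD('n) \<le> (\<Sum>k\<in>UNIV. (h k)\<^sup>2) / 1"
      by (intro divide_left_mono) (auto intro: sum_nonneg simp: Suc_le_eq)
    ultimately show ?thesis by simp
  qed
  finally show ?thesis by simp
qed

section \<open>Joint measurability of the slope\<close>

text \<open>\<open>sorting_choice\<close> gives measurability only for directions on the sphere.
  Sending all other vectors to a fixed unit vector extends it to the whole product space.\<close>

definition unit_part :: "real^'d \<Rightarrow> real^'d" where
  "unit_part \<theta> = (if \<theta> \<in> sphere 0 1 then \<theta> else axis undefined 1)"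

lemma unit_part_sphere: "unit_part \<theta> \<in> sphere 0 1"
  by (simp add: unit_part_def)

lemma sphere_borel [measurable]: "sphere 0 1 \<in> sets (borel :: (real^'d) measure)"
  by (intro borel_closed closed_sphere)

lemma unit_part_measurable [measurable]: "unit_part \<in> borel_measurable borel"
  unfolding unit_part_def[abs_def] by measurable

lemma sorting_measurable [measurable]:
  "(\<lambda>(Y, \<theta>). \<tau> Y (unit_part \<theta>)) \<in> borel \<Otimes>\<^sub>M borel \<rightarrow>\<^sub>M count_space UNIV"
proof -
  have "(\<lambda>(Y, \<theta>). (Y, unit_part \<theta>)) \<in> borel \<Otimes>\<^sub>M borel \<rightarrow>\<^sub>M borel \<Otimes>\<^sub>M restrict_space borel (sphere 0 1)"
    using unit_part_sphere by (auto intro!: measurable_Pair measurable_restrict_space2 simp: split_beta')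
  moreover have "(\<lambda>(X, \<theta>). \<tau> X \<theta>) \<in> borel \<Otimes>\<^sub>M restrict_space borel (sphere 0 1) \<rightarrow>\<^sub>M count_space UNIV"
    using sorting by (simp add: sorting_choice_def)
  ultimately show ?thesis
    by (rule measurable_compose[THEN measurable_cong[THEN iffD1, rotated]]) auto
qed

text \<open>The slope with its matching frozen, which is continuous in \<open>(Y, \<theta>)\<close>;
  the true slope is glued from finitely many of these.\<close>

definition slope_at :: "('n \<Rightarrow> 'n) \<Rightarrow> real^'d^'n::_ \<Rightarrow> real^'d \<Rightarrow> real^'d^'n::_" where
  "slope_at \<sigma> Y \<theta> = (\<chi> k. (2 / real CARD('n)) *\<^sub>R ((\<theta> \<bullet> (Y $ k - Z $ \<sigma> k)) *\<^sub>R \<theta>))"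

lemma slope_eq_slope_at: "\<theta> \<in> sphere 0 1 \<Longrightarrow> slope Y \<theta> = slope_at (matching \<theta> Y) Y \<theta>"
  by (simp add: slope_def slope_at_def phi_def matching_def)

lemma continuous_slope_at: "continuous_on UNIV (\<lambda>p. slope_at \<sigma> (fst p) (snd p))"
  unfolding slope_at_def by (intro continuous_intros)

text \<open>The two sorting permutations are measurable with values in a finite type, so the
  continuous pieces \<open>slope_at\<close> can be glued over these values, one permutation after
  the other.\<close>

lemma slope_measurable [measurable]: "(\<lambda>(Y, \<theta>). slope Y \<theta>) \<in> borel_measurable (borel \<Otimes>\<^sub>M borel)"
proof -
  have slope_at [measurable]: "(\<lambda>p. slope_at \<sigma> (fst p) (snd p)) \<in> borel_measurable (borel \<Otimes>\<^sub>M borel)" for \<sigma>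
    unfolding borel_prod by (intro borel_measurable_continuous_onI continuous_slope_at)
  have t1 [measurable]: "(\<lambda>p. \<tau> (fst p) (unit_part (snd p))) \<in> borel \<Otimes>\<^sub>M borel \<rightarrow>\<^sub>M count_space UNIV"
    using sorting_measurable by (simp add: split_beta')
  have t2 [measurable]: "(\<lambda>p. \<tau> Z (unit_part (snd p))) \<in> borel \<Otimes>\<^sub>M borel \<rightarrow>\<^sub>M count_space UNIV"
    using measurable_compose[OF measurable_Pair[OF measurable_const measurable_snd] sorting_measurable, of Z]
    by simp
  have "(\<lambda>p. slope_at (\<tau> Z (unit_part (snd p)) \<circ> inv (\<tau> (fst p) (unit_part (snd p)))) (fst p) (snd p))
      \<in> borel_measurable (borel \<Otimes>\<^sub>M borel)"
  proof (rule measurable_compose_countable[where f="\<lambda>\<rho> p. slope_at (\<rho> \<circ> inv (\<tau> (fst p) (unit_part (snd p)))) (fst p) (snd p)", OF _ t2])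
    fix \<rho> :: "'n \<Rightarrow> 'n"
    show "(\<lambda>p. slope_at (\<rho> \<circ> inv (\<tau> (fst p) (unit_part (snd p)))) (fst p) (snd p)) \<in> borel_measurable (borel \<Otimes>\<^sub>M borel)"
      by (rule measurable_compose_countable[where f="\<lambda>\<kappa> p. slope_at (\<rho> \<circ> inv \<kappa>) (fst p) (snd p)", OF slope_at t1])
  qed
  then have "(\<lambda>p. if snd p \<in> sphere 0 1 then
      slope_at (\<tau> Z (unit_part (snd p)) \<circ> inv (\<tau> (fst p) (unit_part (snd p)))) (fst p) (snd p) else 0)
      \<in> borel_measurable (borel \<Otimes>\<^sub>M borel)"
    by (intro measurable_If) measurable
  also have "(\<lambda>p. if snd p \<in> sphere 0 1 then
      slope_at (\<tau> Z (unit_part (snd p)) \<circ> inv (\<tau> (fst p) (unit_part (snd p)))) (fst p) (snd p) else 0)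
    = (\<lambda>(Y, \<theta>). slope Y \<theta>)"
    by (auto simp: fun_eq_iff slope_def slope_at_def phi_def unit_part_def)
  finally show ?thesis .
qed

lemma slope_measurable_direction [measurable]: "slope Y \<in> borel_measurable borel"
proof -
  have "(\<lambda>\<theta>. (Y, \<theta>)) \<in> borel \<rightarrow>\<^sub>M borel \<Otimes>\<^sub>M borel" by measurable
  from measurable_compose[OF this slope_measurable] show ?thesis by simp
qed

section \<open>The averaged energy and its gradient almost everywhere\<close>

lemma integrable_slope: "integrable \<mu> (slope Y)"
  by (rule mu.integrable_const_bound[of _ "2 * (norm Y + norm Z)"]) (auto intro!: AE_I2 norm_slope_le simp del: distrib_left_numeral)

lemma integrable_sliced_w2_sq: "integrable \<mu> (\<lambda>\<theta>. sliced_w2_sq Z \<theta> Y)"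
proof (rule mu.integrable_const_bound)
  show "AE \<theta> in \<mu>. norm (sliced_w2_sq Z \<theta> Y) \<le> (norm Y + norm Z)\<^sup>2"
    using sphere_mu by eventually_elim (simp add: sliced_w2_sq_nonneg sliced_w2_sq_bound)
qed simp

lemma energy_nonneg: "energy \<mu> Z Y \<ge> 0"
  by (simp add: energy_def sliced_w2_sq_nonneg)

lemma energy_descent:
  "energy \<mu> Z Y' \<le> energy \<mu> Z Y + mean_slope Y \<bullet> (Y' - Y) + (norm (Y' - Y))\<^sup>2"
proof -
  have "energy \<mu> Z Y' \<le> (\<integral>\<theta>. sliced_w2_sq Z \<theta> Y + slope Y \<theta> \<bullet> (Y' - Y) + (norm (Y' - Y))\<^sup>2 \<partial>\<mu>)"
    unfolding energy_def
  proof (rule integral_mono_AE)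
    show "AE \<theta> in \<mu>. sliced_w2_sq Z \<theta> Y' \<le> sliced_w2_sq Z \<theta> Y + slope Y \<theta> \<bullet> (Y' - Y) + (norm (Y' - Y))\<^sup>2"
      using sphere_mu by eventually_elim (rule sliced_w2_sq_descent)
  qed (intro integrable_sliced_w2_sq integrable_slope Bochner_Integration.integrable_add integrable_inner_left mu.integrable_const)+
  also have "\<dots> = energy \<mu> Z Y + mean_slope Y \<bullet> (Y' - Y) + (norm (Y' - Y))\<^sup>2"
    unfolding energy_def mean_slope_def
    using integrable_sliced_w2_sq[of Y] integrable_slope[of Y] by (simp add: mu.prob_space)
  finally show ?thesis .
qed

text \<open>Without ties, the strict order of the projections persists under small perturbations.
  The matching is then locally constant, and the slope agrees near \<open>Y\<close> with a
  continuous \<open>slope_at\<close>.\<close>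

lemma isCont_slope:
  assumes "inj (\<lambda>k. \<theta> \<bullet> (Y $ k))"
  shows "isCont (\<lambda>Y. slope Y \<theta>) Y"
proof (cases "\<theta> \<in> sphere 0 1")
  case True
  have "\<forall>\<^sub>F X in nhds Y. \<theta> \<bullet> (Y $ k) < \<theta> \<bullet> (Y $ l) \<longrightarrow> \<theta> \<bullet> (X $ k) < \<theta> \<bullet> (X $ l)" for k l
  proof (cases "\<theta> \<bullet> (Y $ k) < \<theta> \<bullet> (Y $ l)")
    case True
    have "((\<lambda>X. \<theta> \<bullet> (X $ l) - \<theta> \<bullet> (X $ k)) \<longlongrightarrow> \<theta> \<bullet> (Y $ l) - \<theta> \<bullet> (Y $ k)) (nhds Y)"
      by (intro tendsto_intros filterlim_ident)
    from order_tendstoD(1)[OF this, of 0] show ?thesis using True by (simp add: eventually_mono)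
  qed simp
  then have "\<forall>\<^sub>F X in nhds Y. \<forall>k l. \<theta> \<bullet> (Y $ k) < \<theta> \<bullet> (Y $ l) \<longrightarrow> \<theta> \<bullet> (X $ k) < \<theta> \<bullet> (X $ l)"
    by (intro eventually_all_finite)
  then have ev: "\<forall>\<^sub>F X in nhds Y. slope_at (matching \<theta> Y) X \<theta> = slope X \<theta>"
  proof eventually_elim
    case (elim X)
    have "inv (\<tau> Y \<theta>) = inv (\<tau> X \<theta>)"
      using assms elim sorting_bij[OF True] sorting_mono[OF True]
      by (intro sorting_permutation_unique[where x="\<lambda>k. \<theta> \<bullet> (Y $ k)" and x'="\<lambda>k. \<theta> \<bullet> (X $ k)"]) auto
    then show ?case by (simp add: slope_eq_slope_at[OF True] matching_def)
  qed
  have "continuous_on UNIV (\<lambda>X. slope_at (matching \<theta> Y) X \<theta>)"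
    unfolding slope_at_def by (intro continuous_intros)
  then have "isCont (\<lambda>X. slope_at (matching \<theta> Y) X \<theta>) Y"
    by (simp add: continuous_on_eq_continuous_at)
  then show ?thesis using isCont_cong[OF ev] by simp
qed (simp add: slope_def)

text \<open>Dominated convergence: a convergent sequence of matrices is bounded, and the slope grows
  at most linearly.\<close>

lemma isCont_mean_slope:
  assumes "AE \<theta> in \<mu>. inj (\<lambda>k. \<theta> \<bullet> (Y $ k))"
  shows "isCont mean_slope Y"
  unfolding continuous_at_sequentially
proof (intro allI impI)
  fix X :: "nat \<Rightarrow> real^'d^'n::_" assume X: "X \<longlonglongrightarrow> Y"
  then obtain K where K: "\<And>i. norm (X i) \<le> K"
    using Bseq_def[THEN iffD1, OF convergent_imp_Bseq] by (auto simp: convergent_def)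
  show "(mean_slope \<circ> X) \<longlonglongrightarrow> mean_slope Y"
    unfolding mean_slope_def comp_def
  proof (rule integral_dominated_convergence)
    show "AE \<theta> in \<mu>. (\<lambda>i. slope (X i) \<theta>) \<longlonglongrightarrow> slope Y \<theta>"
      using assms by eventually_elim (rule isCont_tendsto_compose[OF isCont_slope X])
    show "AE \<theta> in \<mu>. norm (slope (X i) \<theta>) \<le> 2 * (K + norm Z)" for i
      using norm_slope_le[of "X i"] K[of i] by (intro AE_I2) (smt (verit))
  qed simp_all
qed

text \<open>For a fixed nonzero direction the ties fill finitely many hyperplanes; Fubini exchanges
  the two almost-everywhere quantifiers.\<close>

lemma AE_inj_projections: "AE Y in lborel. AE \<theta> in \<mu>. inj (\<lambda>k. \<theta> \<bullet> ((Y :: real^'d^'n::_) $ k))"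
proof -
  interpret P: pair_sigma_finite \<mu> "lborel :: (real^'d^'n::_) measure" ..
  have inj: "inj (\<lambda>k. \<theta> \<bullet> (Y $ k)) \<longleftrightarrow> (\<forall>k. \<forall>l\<in>- {k}. \<theta> \<bullet> (Y $ k) \<noteq> \<theta> \<bullet> (Y $ l))"
    for \<theta> :: "real^'d" and Y :: "real^'d^'n::_"
    by (auto simp: inj_def)
  have "AE \<theta> in \<mu>. AE Y in lborel. inj (\<lambda>k. \<theta> \<bullet> ((Y :: real^'d^'n::_) $ k))"
    using sphere_mu
  proof eventually_elim
    case (elim \<theta>)
    then have "\<theta> \<noteq> 0" by auto
    then show ?case
      unfolding inj by (intro eventually_all_finite eventually_ball_finite ballI negligible_coinciding_projections) auto
  qed
  moreover have [measurable]: "(\<lambda>Y :: real^'d^'n::_. Y $ k) \<in> borel_measurable borel" for k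
    by (intro borel_measurable_continuous_onI continuous_intros)
  moreover have [measurable]: "(\<lambda>p. fst p \<bullet> ((snd p :: real^'d^'n::_) $ k)) \<in> borel_measurable (\<mu> \<Otimes>\<^sub>M lborel)" for k
    by measurable
  moreover have "{p \<in> space (\<mu> \<Otimes>\<^sub>M lborel). inj (\<lambda>k. fst p \<bullet> ((snd p :: real^'d^'n::_) $ k))} \<in> sets (\<mu> \<Otimes>\<^sub>M lborel)"
    unfolding inj by measurable
  ultimately show ?thesis by (subst (asm) P.AE_commute) auto
qed

lemma AE_gderiv_energy: "AE Y in lborel. GDERIV (energy \<mu> Z) Y :> mean_slope Y"
  using AE_inj_projections
  by eventually_elim (intro gderiv_semiconcave energy_descent isCont_mean_slope)

end

section \<open>The standard Gaussian measure\<close>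

lemma nn_integral_standard_gaussian_prod:
  fixes f :: "'a::euclidean_space \<Rightarrow> real \<Rightarrow> ennreal"
  assumes [measurable]: "\<And>b. b \<in> Basis \<Longrightarrow> f b \<in> borel_measurable borel"
  shows "(\<integral>\<^sup>+x. (\<Prod>b\<in>Basis. f b (x \<bullet> b)) \<partial>standard_gaussian) =
    (\<Prod>b\<in>Basis. \<integral>\<^sup>+s. ennreal (std_normal_density s) * f b s \<partial>lborel)"
proof -
  have [measurable]: "(\<lambda>x. \<Prod>b\<in>Basis. f b (x \<bullet> b)) \<in> borel_measurable borel"
    by (intro borel_measurable_prod_ennreal) measurable
  have "(\<integral>\<^sup>+x. (\<Prod>b\<in>Basis. f b (x \<bullet> b)) \<partial>standard_gaussian) =
      (\<integral>\<^sup>+x. (\<Prod>b\<in>Basis. ennreal (std_normal_density (x \<bullet> b)) * f b (x \<bullet> b)) \<partial>lborel)"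
    unfolding standard_gaussian_def
    by (subst nn_integral_density) (auto simp: prod.distrib prod_ennreal normal_density_nonneg)
  also have "\<dots> = (\<Prod>b\<in>Basis. \<integral>\<^sup>+s. ennreal (std_normal_density s) * f b s \<partial>lborel)"
    by (rule nn_integral_lborel_prod) auto
  finally show ?thesis .
qed

lemma nn_integral_std_normal: "(\<integral>\<^sup>+s. ennreal (std_normal_density s) \<partial>lborel) = 1"
  by (subst nn_integral_eq_integral) (auto simp: normal_density_nonneg)

lemma nn_integral_std_normal_power2: "(\<integral>\<^sup>+s. ennreal (std_normal_density s) * ennreal (s\<^sup>2) \<partial>lborel) = 1"
proof -
  have "(\<integral>\<^sup>+s. ennreal (std_normal_density s * s\<^sup>2) \<partial>lborel) = 1"
    using integrable_std_normal_moment[of 2] integral_std_normal_moment_even[of 1]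
    by (subst nn_integral_eq_integral) (auto simp: normal_density_nonneg)
  then show ?thesis by (simp add: ennreal_mult normal_density_nonneg)
qed

lemma sets_standard_gaussian [simp, measurable_cong]: "sets standard_gaussian = sets borel"
  by (simp add: standard_gaussian_def)

lemma space_standard_gaussian [simp]: "space standard_gaussian = UNIV"
  by (simp add: standard_gaussian_def)

lemma prob_space_standard_gaussian: "prob_space (standard_gaussian :: 'a::euclidean_space measure)"
proof
  have "emeasure standard_gaussian (UNIV :: 'a set) = (\<integral>\<^sup>+x. (\<Prod>b\<in>(Basis :: 'a set). 1) \<partial>(standard_gaussian :: 'a measure))"
    by simp
  also have "\<dots> = 1"
    using nn_integral_standard_gaussian_prod[of "\<lambda>(b::'a) s. 1"] by (simp add: nn_integral_std_normal)
  finally show "emeasure standard_gaussian (space standard_gaussian :: 'a set) = 1" by simp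
qed

lemma nn_integral_standard_gaussian_power2:
  assumes "c \<in> (Basis :: 'a::euclidean_space set)"
  shows "(\<integral>\<^sup>+x. ennreal ((x \<bullet> c)\<^sup>2) \<partial>standard_gaussian) = 1"
proof -
  \<comment> \<open>Padding with factors 1 gives the product form that factorises over the
    coordinates.\<close>
  have "ennreal ((x \<bullet> c)\<^sup>2) = (\<Prod>b\<in>Basis. if b = c then ennreal ((x \<bullet> b)\<^sup>2) else 1)" for x :: 'a
    using assms by simp
  then have "(\<integral>\<^sup>+x. ennreal ((x \<bullet> c)\<^sup>2) \<partial>standard_gaussian) =
      (\<integral>\<^sup>+x. (\<Prod>b\<in>Basis. if b = c then ennreal ((x \<bullet> b)\<^sup>2) else 1) \<partial>(standard_gaussian :: 'a measure))"
    by simp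
  also have "\<dots> = (\<Prod>b\<in>(Basis :: 'a set). \<integral>\<^sup>+s. ennreal (std_normal_density s) * (if b = c then ennreal (s\<^sup>2) else 1) \<partial>lborel)"
    by (rule nn_integral_standard_gaussian_prod[of "\<lambda>b s. if b = c then ennreal (s\<^sup>2) else 1"]) simp
  also have "\<dots> = (\<Prod>b\<in>(Basis :: 'a set). 1)"
  proof (intro prod.cong refl)
    fix b :: 'a
    show "(\<integral>\<^sup>+s. ennreal (std_normal_density s) * (if b = c then ennreal (s\<^sup>2) else 1) \<partial>lborel) = 1"
      by (cases "b = c") (simp_all add: nn_integral_std_normal nn_integral_std_normal_power2)
  qed
  finally show ?thesis by simp
qed

lemma integrable_standard_gaussian_norm2: "integrable standard_gaussian (\<lambda>x::'a::euclidean_space. (norm x)\<^sup>2)"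
proof -
  have "integrable standard_gaussian (\<lambda>x::'a. (x \<bullet> c)\<^sup>2)" if "c \<in> Basis" for c
    by (rule integrableI_nonneg) (auto simp: nn_integral_standard_gaussian_power2[OF that])
  then have "integrable standard_gaussian (\<lambda>x::'a. \<Sum>c\<in>Basis. (x \<bullet> c)\<^sup>2)"
    by (intro Bochner_Integration.integrable_sum)
  moreover have "(\<Sum>c\<in>Basis. (x \<bullet> c)\<^sup>2) = (norm x)\<^sup>2" for x :: 'a
    unfolding power2_norm_eq_inner by (subst euclidean_inner) (simp add: power2_eq_square)
  ultimately show ?thesis by simp
qed

lemma integrable_standard_gaussian_ident: "integrable standard_gaussian (\<lambda>x::'a::euclidean_space. x)"
proof -
  interpret prob_space "standard_gaussian :: 'a measure" by (rule prob_space_standard_gaussian)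
  have "integrable standard_gaussian (\<lambda>x::'a. 1 + (norm x)\<^sup>2)"
    by (intro Bochner_Integration.integrable_add integrable_const integrable_standard_gaussian_norm2)
  then show ?thesis
  proof (rule Bochner_Integration.integrable_bound)
    have "norm x \<le> 1 + (norm x)\<^sup>2" for x :: 'a
      using sum_squares_bound[of 1 "norm x"] by (simp add: power2_eq_square) (smt (verit) norm_ge_zero)
    then show "AE x in standard_gaussian. norm x \<le> norm (1 + (norm (x::'a))\<^sup>2)"
      by (intro AE_I2) auto
  qed simp
qed

lemma AE_lborel_affine:
  assumes "AE x in lborel. P (x :: 'a::euclidean_space)" "c \<noteq> 0"
  shows "AE x in lborel. P (t + c *\<^sub>R x)"
proof -
  have "AE x in density (distr lborel borel (\<lambda>x. t + c *\<^sub>R x)) (\<lambda>_. ennreal (\<bar>c\<bar> ^ DIM('a))). P x"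
    using assms(1) by (subst (asm) lborel_affine[OF assms(2), of t])
  then have "AE x in distr lborel borel (\<lambda>x. t + c *\<^sub>R x). P x"
    using assms(2) by (subst (asm) AE_density) auto
  then show ?thesis by (rule AE_distrD[rotated]) simp
qed

text \<open>The density is even and \<open>x -> - x\<close> preserves Lebesgue measure, so the mean
  equals its own negative.\<close>

lemma integral_standard_gaussian_ident: "(\<integral>x. x \<partial>(standard_gaussian :: 'a::euclidean_space measure)) = 0"
proof -
  define \<rho> where "\<rho> x = (\<Prod>b\<in>Basis. std_normal_density (x \<bullet> b))" for x :: 'a
  have \<rho>: "\<rho> x \<ge> 0" "\<rho> (- x) = \<rho> x" for x
    by (auto simp: \<rho>_def normal_density_nonneg normal_density_def intro: prod_nonneg)
  have [measurable]: "\<rho> \<in> borel_measurable borel" unfolding \<rho>_def[abs_def] by measurable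
  have "(\<integral>x. x \<partial>(standard_gaussian :: 'a measure)) = (\<integral>x. \<rho> x *\<^sub>R x \<partial>lborel)"
    unfolding standard_gaussian_def \<rho>_def[symmetric] using \<rho> by (subst integral_density) auto
  also have "\<dots> = (\<integral>x. \<rho> x *\<^sub>R x \<partial>density (distr lborel borel (\<lambda>x. 0 + (-1) *\<^sub>R x)) (\<lambda>_. ennreal (\<bar>-1\<bar> ^ DIM('a))))"
    by (subst lborel_affine[of "-1" 0]) auto
  also have "\<dots> = (\<integral>x. \<rho> x *\<^sub>R x \<partial>distr lborel borel (\<lambda>x. 0 + (-1) *\<^sub>R x))"
    by (simp add: density_1)
  also have "\<dots> = (\<integral>x. \<rho> (- x) *\<^sub>R (- x) \<partial>lborel)"
    by (subst integral_distr) auto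
  also have "\<dots> = - (\<integral>x. \<rho> x *\<^sub>R x \<partial>lborel)" by (simp add: \<rho>)
  also have "(\<integral>x. \<rho> x *\<^sub>R x \<partial>lborel) = (\<integral>x. x \<partial>(standard_gaussian :: 'a measure))"
    unfolding standard_gaussian_def \<rho>_def[symmetric] using \<rho> by (subst integral_density) auto
  finally show ?thesis by (simp add: eq_neg_iff_add_eq_0 flip: scaleR_2)
qed

text \<open>The Gaussian has a density and invertible affine maps preserve Lebesgue null sets. This
  is what keeps a noisy step out of a given null set.\<close>

lemma AE_standard_gaussian_affine:
  assumes "AE x in lborel. P (x :: 'a::euclidean_space)" "c \<noteq> 0"
  shows "AE x in standard_gaussian. P (t + c *\<^sub>R x)"
  unfolding standard_gaussian_def using AE_lborel_affine[OF assms, of t]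
  by (subst AE_density) auto

section \<open>Stochastic descent for semiconcave functions\<close>

lemma distr_pair_snd:
  assumes "prob_space M" "sigma_finite_measure N"
  shows "distr (M \<Otimes>\<^sub>M N) N snd = N"
proof (rule measure_eqI)
  interpret M: prob_space M by fact
  interpret N: sigma_finite_measure N by fact
  fix A assume A: "A \<in> sets (distr (M \<Otimes>\<^sub>M N) N snd)"
  then have "snd -` A \<inter> space (M \<Otimes>\<^sub>M N) = space M \<times> A"
    by (auto simp: space_pair_measure dest: sets.sets_into_space)
  then show "emeasure (distr (M \<Otimes>\<^sub>M N) N snd) A = emeasure N A"
    using A by (simp add: emeasure_distr N.emeasure_pair_measure_Times M.emeasure_space_1)
qed simp

section \<open>Resampling one noise coordinate\<close>

text \<open>Replacing one coordinate of an i.i.d. family by an independent fresh draw leaves its law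
  unchanged.\<close>

lemma nn_integral_PiM_resample:
  fixes f :: "('i \<Rightarrow> 'b) \<Rightarrow> ennreal"
  assumes M: "prob_space M" and f [measurable]: "f \<in> borel_measurable (\<Pi>\<^sub>M i\<in>UNIV. M)"
  shows "(\<integral>\<^sup>+w. \<integral>\<^sup>+x. f (w(t := x)) \<partial>M \<partial>(\<Pi>\<^sub>M i\<in>UNIV. M)) = (\<integral>\<^sup>+w. f w \<partial>(\<Pi>\<^sub>M i\<in>UNIV. M))"
proof -
  interpret M: prob_space M by fact
  interpret S: prob_space "\<Pi>\<^sub>M i\<in>(UNIV::'i set). M" by (intro prob_space_PiM M)
  interpret P: pair_sigma_finite M "\<Pi>\<^sub>M i\<in>(UNIV::'i set). M" ..
  have upd [measurable]: "(\<lambda>(x, w). w(t := x)) \<in> M \<Otimes>\<^sub>M (\<Pi>\<^sub>M i\<in>UNIV. M) \<rightarrow>\<^sub>M (\<Pi>\<^sub>M i\<in>UNIV. M)"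
    using measurable_fun_upd[of UNIV UNIV t snd "M \<Otimes>\<^sub>M (\<Pi>\<^sub>M i\<in>UNIV. M)" "\<lambda>_. M" fst]
    by (simp add: split_beta')
  have "(\<integral>\<^sup>+w. f w \<partial>(\<Pi>\<^sub>M i\<in>UNIV. M)) =
      (\<integral>\<^sup>+w. f w \<partial>distr (M \<Otimes>\<^sub>M (\<Pi>\<^sub>M i\<in>UNIV. M)) (\<Pi>\<^sub>M i\<in>UNIV. M) (\<lambda>(x, w). w(t := x)))"
    using distr_pair_PiM_eq_PiM[of UNIV "\<lambda>_::'i. M" t] M by simp
  also have "\<dots> = (\<integral>\<^sup>+p. f ((snd p)(t := fst p)) \<partial>(M \<Otimes>\<^sub>M (\<Pi>\<^sub>M i\<in>UNIV. M)))"
    by (subst nn_integral_distr[OF upd]) (simp_all add: split_beta')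
  also have "\<dots> = (\<integral>\<^sup>+w. \<integral>\<^sup>+x. f (w(t := x)) \<partial>M \<partial>(\<Pi>\<^sub>M i\<in>UNIV. M))"
    using upd by (subst P.nn_integral_snd[symmetric]) (simp_all add: split_beta')
  finally show ?thesis by simp
qed

text \<open>Isolates the features of the sliced energies behind convergence: linear growth of the
  sampled slope, the semiconcave descent inequality for its mean \<open>g\<close>, and
  \<open>g\<close> being the gradient almost everywhere.\<close>

locale noisy_sgd =
  fixes \<phi> :: "'a::euclidean_space \<Rightarrow> 'b::topological_space \<Rightarrow> 'a"
    and g :: "'a \<Rightarrow> 'a" and F :: "'a \<Rightarrow> real"
    and \<mu> :: "'b measure" and \<nu> :: "'a measure"
    and \<alpha> :: "nat \<Rightarrow> real" and a C :: real
  assumes prob_mu: "prob_space \<mu>" and sets_mu [measurable_cong]: "sets \<mu> = sets borel"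
    and prob_nu: "prob_space \<nu>" and sets_nu [measurable_cong]: "sets \<nu> = sets borel"
    and nu_ac: "absolutely_continuous lborel \<nu>"
    and phi_measurable [measurable]: "(\<lambda>(y, x). \<phi> y x) \<in> borel_measurable (borel \<Otimes>\<^sub>M borel)"
    and norm_phi_le: "\<And>y x. norm (\<phi> y x) \<le> C * (1 + norm y)"
    and g_eq: "\<And>y. g y = (\<integral>x. \<phi> y x \<partial>\<mu>)"
    and F_nonneg: "\<And>y. F y \<ge> 0"
    and F_descent: "\<And>x y. F y \<le> F x + g x \<bullet> (y - x) + (norm (y - x))\<^sup>2"
    and F_gderiv: "AE y in lborel. GDERIV F y :> g y"
    and alpha_nonneg: "\<And>t. \<alpha> t \<ge> 0"
    and alpha_diverges: "filterlim (\<lambda>T. \<Sum>t<T. \<alpha> t) at_top sequentially"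
    and alpha_square: "summable (\<lambda>t. (\<alpha> t)\<^sup>2)"
    and a_pos: "a > 0"
begin

abbreviation \<gamma> :: "'a measure" where "\<gamma> \<equiv> standard_gaussian"

definition Q :: "('a \<times> (nat \<Rightarrow> 'b) \<times> (nat \<Rightarrow> 'a)) measure" where
  "Q = \<nu> \<Otimes>\<^sub>M ((\<Pi>\<^sub>M t\<in>UNIV. \<mu>) \<Otimes>\<^sub>M (\<Pi>\<^sub>M t\<in>UNIV. \<gamma>))"

sublocale mu: prob_space \<mu> by (rule prob_mu)
sublocale nu: prob_space \<nu> by (rule prob_nu)
sublocale gauss: prob_space \<gamma> by (rule prob_space_standard_gaussian)
sublocale mus: prob_space "\<Pi>\<^sub>M t\<in>(UNIV::nat set). \<mu>" by (intro prob_space_PiM prob_mu)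
sublocale gausss: prob_space "\<Pi>\<^sub>M t\<in>(UNIV::nat set). \<gamma>" by (intro prob_space_PiM gauss.prob_space_axioms)
sublocale noises: pair_prob_space "\<Pi>\<^sub>M t\<in>(UNIV::nat set). \<mu>" "\<Pi>\<^sub>M t\<in>(UNIV::nat set). \<gamma>" ..
sublocale noise: pair_prob_space \<mu> \<gamma> ..
sublocale Qpair: pair_prob_space \<nu> "(\<Pi>\<^sub>M t\<in>(UNIV::nat set). \<mu>) \<Otimes>\<^sub>M (\<Pi>\<^sub>M t\<in>(UNIV::nat set). \<gamma>)" ..
sublocale Q: prob_space Q unfolding Q_def by (rule Qpair.prob_space_axioms)
sublocale QN: pair_prob_space Q "\<mu> \<Otimes>\<^sub>M \<gamma>" ..

lemma sets_Q [measurable_cong]: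
  "sets Q = sets (borel \<Otimes>\<^sub>M ((\<Pi>\<^sub>M t\<in>UNIV. borel) \<Otimes>\<^sub>M (\<Pi>\<^sub>M t\<in>UNIV. borel)))"
  unfolding Q_def by (intro sets_pair_measure_cong sets_PiM_cong) (auto simp: sets_mu sets_nu)

lemma space_mu [simp]: "space \<mu> = UNIV" and space_nu [simp]: "space \<nu> = UNIV"
  using sets_eq_imp_space_eq[OF sets_mu] sets_eq_imp_space_eq[OF sets_nu] by simp_all

lemma space_Q [simp]: "space Q = UNIV"
  unfolding Q_def by (simp add: space_pair_measure space_PiM)

lemma measure_mu_UNIV [simp]: "measure \<mu> UNIV = 1" and measure_Q_UNIV [simp]: "measure Q UNIV = 1"
  using mu.prob_space Q.prob_space by simp_all

text \<open>Index \<open>t\<close> receives a fresh direction \<open>x\<close> and a fresh Gaussian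
  \<open>z\<close>. As this preserves \<open>Q\<close>, integrating over \<open>(x, z)\<close> with
  \<open>q\<close> fixed takes the place of conditioning on the other coordinates.\<close>

fun resample :: "nat \<Rightarrow> ('a \<times> (nat \<Rightarrow> 'b) \<times> (nat \<Rightarrow> 'a)) \<times> ('b \<times> 'a) \<Rightarrow> 'a \<times> (nat \<Rightarrow> 'b) \<times> (nat \<Rightarrow> 'a)" where
  "resample t ((y, \<theta>, e), (x, z)) = (y, \<theta>(t := x), e(t := z))"

lemma resample_simps [simp]:
  "fst (resample t (q, p)) = fst q"
  "fst (snd (resample t (q, p))) = (fst (snd q))(t := fst p)"
  "snd (snd (resample t (q, p))) = (snd (snd q))(t := snd p)"
  by (cases q; cases p; simp)+

lemma resample_eq:
  "resample t = (\<lambda>r. (fst (fst r), (fst (snd (fst r)))(t := fst (snd r)), (snd (snd (fst r)))(t := snd (snd r))))"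
  by (auto simp: fun_eq_iff)

lemma measurable_upd [measurable (raw)]:
  assumes [measurable]: "f \<in> N \<rightarrow>\<^sub>M (\<Pi>\<^sub>M i\<in>UNIV. M)" "h \<in> N \<rightarrow>\<^sub>M M"
  shows "(\<lambda>w. (f w)(t := h w)) \<in> N \<rightarrow>\<^sub>M (\<Pi>\<^sub>M i\<in>UNIV. M)"
  using measurable_fun_upd[of UNIV UNIV t f N "\<lambda>_. M" h] assms by simp

lemma resample_measurable [measurable]: "resample t \<in> Q \<Otimes>\<^sub>M (\<mu> \<Otimes>\<^sub>M \<gamma>) \<rightarrow>\<^sub>M Q"
  unfolding resample_eq by measurable

lemma nn_integral_Q:
  assumes f [measurable]: "f \<in> borel_measurable Q"
  shows "(\<integral>\<^sup>+q. f q \<partial>Q) =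
    (\<integral>\<^sup>+y. \<integral>\<^sup>+\<theta>. \<integral>\<^sup>+e. f (y, \<theta>, e) \<partial>(\<Pi>\<^sub>M t\<in>UNIV. \<gamma>) \<partial>(\<Pi>\<^sub>M t\<in>UNIV. \<mu>) \<partial>\<nu>)"
proof -
  let ?S = "\<Pi>\<^sub>M t\<in>(UNIV::nat set). \<mu>" and ?T = "\<Pi>\<^sub>M t\<in>(UNIV::nat set). \<gamma>"
  have f' [measurable]: "f \<in> borel_measurable (\<nu> \<Otimes>\<^sub>M (?S \<Otimes>\<^sub>M ?T))" using f by (simp add: Q_def)
  have "(\<integral>\<^sup>+q. f q \<partial>Q) = (\<integral>\<^sup>+y. \<integral>\<^sup>+r. f (y, r) \<partial>(?S \<Otimes>\<^sub>M ?T) \<partial>\<nu>)"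
    unfolding Q_def by (rule noises.nn_integral_fst[symmetric]) measurable
  also have "\<dots> = (\<integral>\<^sup>+y. \<integral>\<^sup>+\<theta>. \<integral>\<^sup>+e. f (y, \<theta>, e) \<partial>?T \<partial>?S \<partial>\<nu>)"
    by (intro nn_integral_cong gausss.nn_integral_fst[symmetric]) measurable
  finally show ?thesis .
qed

lemma nn_integral_resample:
  assumes f [measurable]: "f \<in> borel_measurable Q"
  shows "(\<integral>\<^sup>+q. \<integral>\<^sup>+p. f (resample t (q, p)) \<partial>(\<mu> \<Otimes>\<^sub>M \<gamma>) \<partial>Q) = (\<integral>\<^sup>+q. f q \<partial>Q)"
proof -
  let ?S = "\<Pi>\<^sub>M t\<in>(UNIV::nat set). \<mu>" and ?T = "\<Pi>\<^sub>M t\<in>(UNIV::nat set). \<gamma>"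
  have [measurable]: "f \<in> borel_measurable (\<nu> \<Otimes>\<^sub>M (?S \<Otimes>\<^sub>M ?T))" using f by (simp add: Q_def)
  have "(\<integral>\<^sup>+p. f (resample t (q, p)) \<partial>(\<mu> \<Otimes>\<^sub>M \<gamma>)) = (\<integral>\<^sup>+x. \<integral>\<^sup>+z. f (resample t (q, (x, z))) \<partial>\<gamma> \<partial>\<mu>)" for q
    by (rule gauss.nn_integral_fst[symmetric]) measurable
  then have "(\<integral>\<^sup>+q. \<integral>\<^sup>+p. f (resample t (q, p)) \<partial>(\<mu> \<Otimes>\<^sub>M \<gamma>) \<partial>Q) =
      (\<integral>\<^sup>+y. \<integral>\<^sup>+\<theta>. \<integral>\<^sup>+e. \<integral>\<^sup>+x. \<integral>\<^sup>+z. f (y, \<theta>(t := x), e(t := z)) \<partial>\<gamma> \<partial>\<mu> \<partial>?T \<partial>?S \<partial>\<nu>)"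
    by (simp add: nn_integral_Q)
  \<comment> \<open>The fresh direction is moved outside the Gaussian sequence, so that each
    sequence can be resampled separately.\<close>
  also have "\<dots> = (\<integral>\<^sup>+y. \<integral>\<^sup>+\<theta>. \<integral>\<^sup>+x. \<integral>\<^sup>+e. \<integral>\<^sup>+z. f (y, \<theta>(t := x), e(t := z)) \<partial>\<gamma> \<partial>?T \<partial>\<mu> \<partial>?S \<partial>\<nu>)"
  proof -
    interpret P: pair_sigma_finite \<mu> ?T ..
    have "(\<integral>\<^sup>+e. \<integral>\<^sup>+x. \<integral>\<^sup>+z. f (y, \<theta>(t := x), e(t := z)) \<partial>\<gamma> \<partial>\<mu> \<partial>?T) =
        (\<integral>\<^sup>+x. \<integral>\<^sup>+e. \<integral>\<^sup>+z. f (y, \<theta>(t := x), e(t := z)) \<partial>\<gamma> \<partial>?T \<partial>\<mu>)"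
      if [measurable]: "\<theta> \<in> space ?S" for y \<theta>
      by (rule P.Fubini') measurable
    then show ?thesis by (intro nn_integral_cong) auto
  qed
  also have "\<dots> = (\<integral>\<^sup>+y. \<integral>\<^sup>+\<theta>. \<integral>\<^sup>+x. \<integral>\<^sup>+e. f (y, \<theta>(t := x), e) \<partial>?T \<partial>\<mu> \<partial>?S \<partial>\<nu>)"
    by (intro nn_integral_cong nn_integral_PiM_resample gauss.prob_space_axioms) measurable
  also have "\<dots> = (\<integral>\<^sup>+y. \<integral>\<^sup>+\<theta>. \<integral>\<^sup>+e. f (y, \<theta>, e) \<partial>?T \<partial>?S \<partial>\<nu>)"
    by (intro nn_integral_cong nn_integral_PiM_resample[where f="\<lambda>\<theta>. \<integral>\<^sup>+e. f (_, \<theta>, e) \<partial>?T"] prob_mu) measurable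
  also have "\<dots> = (\<integral>\<^sup>+q. f q \<partial>Q)"
    by (rule nn_integral_Q[symmetric]) measurable
  finally show ?thesis .
qed

lemma distr_resample: "distr (Q \<Otimes>\<^sub>M (\<mu> \<Otimes>\<^sub>M \<gamma>)) Q (resample t) = Q"
proof (rule measure_eqI)
  fix A assume "A \<in> sets (distr (Q \<Otimes>\<^sub>M (\<mu> \<Otimes>\<^sub>M \<gamma>)) Q (resample t))"
  then have [measurable]: "A \<in> sets Q" by simp
  have "emeasure (distr (Q \<Otimes>\<^sub>M (\<mu> \<Otimes>\<^sub>M \<gamma>)) Q (resample t)) A =
      (\<integral>\<^sup>+q. indicator A q \<partial>distr (Q \<Otimes>\<^sub>M (\<mu> \<Otimes>\<^sub>M \<gamma>)) Q (resample t))"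
    by simp
  also have "\<dots> = (\<integral>\<^sup>+r. indicator A (resample t r) \<partial>(Q \<Otimes>\<^sub>M (\<mu> \<Otimes>\<^sub>M \<gamma>)))"
    by (rule nn_integral_distr) measurable
  also have "\<dots> = (\<integral>\<^sup>+q. \<integral>\<^sup>+p. indicator A (resample t (q, p)) \<partial>(\<mu> \<Otimes>\<^sub>M \<gamma>) \<partial>Q)"
    by (rule noise.nn_integral_fst[symmetric]) measurable
  also have "\<dots> = emeasure Q A" by (subst nn_integral_resample) auto
  finally show "emeasure (distr (Q \<Otimes>\<^sub>M (\<mu> \<Otimes>\<^sub>M \<gamma>)) Q (resample t)) A = emeasure Q A" .
qed simp

text \<open>The filtration consists of the events that ignore all noise with index above \<open>j\<close>; this avoids
  factoring measurable functions through the first \<open>j\<close> coordinates.\<close>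

definition past :: "nat \<Rightarrow> ('a \<times> (nat \<Rightarrow> 'b) \<times> (nat \<Rightarrow> 'a)) measure" where
  "past j = sigma UNIV {A\<in>sets Q. \<forall>i>j. \<forall>q p. resample i (q, p) \<in> A \<longleftrightarrow> q \<in> A}"

lemma space_past [simp]: "space (past j) = UNIV"
  by (simp add: past_def space_measure_of_conv)

text \<open>Invariance under resampling passes to complements and countable unions, so the
  generating family is already a sigma-algebra.\<close>

lemma sets_past: "sets (past j) = {A\<in>sets Q. \<forall>i>j. \<forall>q p. resample i (q, p) \<in> A \<longleftrightarrow> q \<in> A}"
proof -
  let ?A = "{A\<in>sets Q. \<forall>i>j. \<forall>q p. resample i (q, p) \<in> A \<longleftrightarrow> q \<in> A}"
  have "sigma_algebra UNIV ?A"
    unfolding sigma_algebra_iff2 using sets.compl_sets[of _ Q]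
    by (auto simp: image_subset_iff simp del: split_paired_All)
  then show ?thesis
    unfolding past_def by (rule sigma_algebra.sets_measure_of_eq)
qed

lemma subalgebra_past: "subalgebra Q (past j)"
  by (auto simp: subalgebra_def sets_past)

text \<open>Points are closed in a T1 space, so the level set through \<open>q\<close> belongs to
  \<open>past j\<close> and resampling cannot leave it.\<close>

lemma measurable_past_iff:
  fixes X :: "_ \<Rightarrow> 'c::t1_space"
  shows "X \<in> borel_measurable (past j) \<longleftrightarrow>
    X \<in> borel_measurable Q \<and> (\<forall>i>j. \<forall>q p. X (resample i (q, p)) = X q)"
proof safe
  assume X: "X \<in> borel_measurable (past j)"
  then show "X \<in> borel_measurable Q"
    using measurable_from_subalg[OF subalgebra_past] by blast
  fix i q p assume "j < i"
  have "X -` {X q} \<inter> space (past j) \<in> sets (past j)"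
    by (rule measurable_sets[OF X]) (auto intro: borel_closed)
  with \<open>j < i\<close> show "X (resample i (q, p)) = X q"
    by (auto simp: sets_past simp del: split_paired_All)
next
  assume X: "X \<in> borel_measurable Q" "\<forall>i>j. \<forall>q p. X (resample i (q, p)) = X q"
  show "X \<in> borel_measurable (past j)"
  proof (rule measurableI)
    fix A :: "'c set" assume "A \<in> sets borel"
    with X(1) have "X -` A \<inter> space Q \<in> sets Q" by (rule measurable_sets)
    then show "X -` A \<inter> space (past j) \<in> sets (past j)" using X(2) by (simp add: sets_past)
  qed simp
qed

end

context noisy_sgd
begin

section \<open>The trajectory on the canonical space and its noise\<close>

text \<open>Step \<open>t\<close> reads noise index \<open>Suc t\<close>, so \<open>state t\<close>
  is unaffected by resampling any index above \<open>t\<close>.\<close>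

primrec state :: "nat \<Rightarrow> 'a \<times> (nat \<Rightarrow> 'b) \<times> (nat \<Rightarrow> 'a) \<Rightarrow> 'a" where
  "state 0 q = fst q"
| "state (Suc t) q = state t q - \<alpha> t *\<^sub>R \<phi> (state t q) (fst (snd q) (Suc t)) + (\<alpha> t * a) *\<^sub>R snd (snd q) (Suc t)"

lemma C_nonneg: "C \<ge> 0"
  using order_trans[OF norm_ge_zero norm_phi_le[of 0 undefined]] by simp

text \<open>Sampling error of the slope plus the Gaussian perturbation, before scaling by
  \<open>\<alpha> t\<close>. Its mean over fresh noise at index \<open>Suc t\<close> is
  zero.\<close>

definition noise :: "nat \<Rightarrow> 'a \<times> (nat \<Rightarrow> 'b) \<times> (nat \<Rightarrow> 'a) \<Rightarrow> 'a" where
  "noise t q = g (state t q) - \<phi> (state t q) (fst (snd q) (Suc t)) + a *\<^sub>R snd (snd q) (Suc t)"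

lemma state_Suc_eq: "state (Suc t) q = state t q - \<alpha> t *\<^sub>R g (state t q) + \<alpha> t *\<^sub>R noise t q"
  by (simp add: noise_def algebra_simps)

lemma g_measurable [measurable]: "g \<in> borel_measurable borel"
  unfolding g_eq[abs_def] by measurable

lemma phi_measurable_mu [measurable]: "\<phi> y \<in> borel_measurable \<mu>"
proof -
  have "(\<lambda>x. (y, x)) \<in> \<mu> \<rightarrow>\<^sub>M borel \<Otimes>\<^sub>M borel" by measurable
  from measurable_compose[OF this phi_measurable] show ?thesis by simp
qed

lemma integrable_phi: "integrable \<mu> (\<phi> y)"
  by (rule mu.integrable_const_bound[of _ "C * (1 + norm y)"]) (auto intro!: AE_I2 norm_phi_le)

lemma norm_g_le: "norm (g y) \<le> C * (1 + norm y)"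
proof -
  have "norm (g y) \<le> (\<integral>x. norm (\<phi> y x) \<partial>\<mu>)" unfolding g_eq by (rule integral_norm_bound)
  also have "\<dots> \<le> (\<integral>x. C * (1 + norm y) \<partial>\<mu>)"
    using integrable_phi norm_phi_le by (intro integral_mono) auto
  finally show ?thesis by (simp add: mu.prob_space)
qed

lemma coordinates_measurable [measurable]:
  "(\<lambda>q. fst (snd q) t) \<in> borel_measurable Q" "(\<lambda>q. snd (snd q) t) \<in> borel_measurable Q"
  by measurable

lemma state_measurable [measurable]: "state t \<in> borel_measurable Q"
proof (induction t)
  case (Suc t)
  note Suc [measurable]
  have "(\<lambda>q. \<phi> (state t q) (fst (snd q) (Suc t))) \<in> borel_measurable Q"
    using measurable_compose[OF measurable_Pair phi_measurable, of "state t" Q "\<lambda>q. fst (snd q) (Suc t)"] by simp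
  then show ?case by simp
qed (simp add: measurable_cong_sets[OF sets_Q refl])

lemma phi_state_measurable [measurable]: "(\<lambda>q. \<phi> (state t q) (fst (snd q) (Suc t))) \<in> borel_measurable Q"
  using measurable_compose[OF measurable_Pair phi_measurable, of "state t" Q "\<lambda>q. fst (snd q) (Suc t)"] by simp

lemma noise_measurable [measurable]: "noise t \<in> borel_measurable Q"
  unfolding noise_def[abs_def] by measurable

lemma state_resample: "t < i \<Longrightarrow> state t (resample i (q, p)) = state t q"
  by (induction t) auto

lemma noise_resample: "Suc t < i \<Longrightarrow> noise t (resample i (q, p)) = noise t q"
  by (simp add: noise_def state_resample)

lemma noise_resample_Suc:
  "noise t (resample (Suc t) (q, p)) = g (state t q) - \<phi> (state t q) (fst p) + a *\<^sub>R snd p"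
  by (simp add: noise_def state_resample)

lemma integral_pair_noise:
  "integrable (\<mu> \<Otimes>\<^sub>M \<gamma>) (\<lambda>p. g y - \<phi> y (fst p) + a *\<^sub>R snd p)"
  "(\<integral>p. g y - \<phi> y (fst p) + a *\<^sub>R snd p \<partial>(\<mu> \<Otimes>\<^sub>M \<gamma>)) = 0"
proof -
  have d1: "distr (\<mu> \<Otimes>\<^sub>M \<gamma>) \<mu> fst = \<mu>" by (rule gauss.distr_pair_fst)
  have d2: "distr (\<mu> \<Otimes>\<^sub>M \<gamma>) \<gamma> snd = \<gamma>"
    by (rule distr_pair_snd) (rule prob_mu, rule gauss.sigma_finite_measure_axioms)
  have i1: "integrable (\<mu> \<Otimes>\<^sub>M \<gamma>) (\<lambda>p. \<phi> y (fst p))"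
    using integrable_phi[of y] by (subst (asm) d1[symmetric], subst (asm) integrable_distr_eq) auto
  have i2: "integrable (\<mu> \<Otimes>\<^sub>M \<gamma>) (\<lambda>p. snd p)"
    using integrable_standard_gaussian_ident[where 'a='a]
    by (subst (asm) d2[symmetric], subst (asm) integrable_distr_eq) auto
  have e1: "(\<integral>p. \<phi> y (fst p) \<partial>(\<mu> \<Otimes>\<^sub>M \<gamma>)) = g y"
    unfolding g_eq by (subst (2) d1[symmetric], subst integral_distr) auto
  have e2: "(\<integral>p. snd p \<partial>(\<mu> \<Otimes>\<^sub>M \<gamma>)) = 0"
    unfolding integral_standard_gaussian_ident[symmetric] by (subst (2) d2[symmetric], subst integral_distr) auto
  show "integrable (\<mu> \<Otimes>\<^sub>M \<gamma>) (\<lambda>p. g y - \<phi> y (fst p) + a *\<^sub>R snd p)"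
    using i1 i2 by auto
  show "(\<integral>p. g y - \<phi> y (fst p) + a *\<^sub>R snd p \<partial>(\<mu> \<Otimes>\<^sub>M \<gamma>)) = 0"
    using i1 i2 by (simp add: e1 e2 noise.prob_space)
qed

lemma integrable_gaussian_coordinate:
  "integrable Q (\<lambda>q. (norm (snd (snd q) t))\<^sup>2)"
  "(\<integral>q. (norm (snd (snd q) t))\<^sup>2 \<partial>Q) = (\<integral>z. (norm z)\<^sup>2 \<partial>\<gamma>)"
proof -
  have "(\<integral>\<^sup>+q. ennreal ((norm (snd (snd q) t))\<^sup>2) \<partial>Q) =
      (\<integral>\<^sup>+q. \<integral>\<^sup>+p. ennreal ((norm (snd p))\<^sup>2) \<partial>(\<mu> \<Otimes>\<^sub>M \<gamma>) \<partial>Q)"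
    by (subst nn_integral_resample[of _ t, symmetric]) simp_all
  also have "\<dots> = (\<integral>\<^sup>+p. ennreal ((norm (snd p))\<^sup>2) \<partial>(\<mu> \<Otimes>\<^sub>M \<gamma>))"
    by (simp add: Q.emeasure_space_1[simplified])
  also have "\<dots> = (\<integral>\<^sup>+x. \<integral>\<^sup>+z. ennreal ((norm (snd (x, z)))\<^sup>2) \<partial>\<gamma> \<partial>\<mu>)"
    by (rule gauss.nn_integral_fst[symmetric]) measurable
  also have "\<dots> = (\<integral>\<^sup>+z. ennreal ((norm z)\<^sup>2) \<partial>\<gamma>)"
    using mu.emeasure_space_1 by simp
  also have "\<dots> = ennreal (\<integral>z. (norm z)\<^sup>2 \<partial>\<gamma>)"
    by (rule nn_integral_eq_integral[OF integrable_standard_gaussian_norm2]) simp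
  finally have e: "(\<integral>\<^sup>+q. ennreal ((norm (snd (snd q) t))\<^sup>2) \<partial>Q) = ennreal (\<integral>z. (norm z)\<^sup>2 \<partial>\<gamma>)" .
  show i: "integrable Q (\<lambda>q. (norm (snd (snd q) t))\<^sup>2)"
    by (rule integrableI_nonneg) (auto simp: e)
  show "(\<integral>q. (norm (snd (snd q) t))\<^sup>2 \<partial>Q) = (\<integral>z. (norm z)\<^sup>2 \<partial>\<gamma>)"
    by (rule integral_eq_nn_integral[THEN trans]) (auto simp: e integral_nonneg_AE)
qed

text \<open>By Tonelli the expected sum is the Gaussian second moment times the sum of
  \<open>(\<alpha> t)^2\<close>, hence finite. This controls the second-order terms of the
  descent.\<close>

lemma AE_summable_gaussian: "AE q in Q. summable (\<lambda>t. (\<alpha> t)\<^sup>2 * (norm (snd (snd q) (Suc t)))\<^sup>2)"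
proof -
  let ?V = "\<integral>z. (norm z)\<^sup>2 \<partial>\<gamma>"
  have "(\<integral>\<^sup>+q. (\<Sum>t. ennreal ((\<alpha> t)\<^sup>2 * (norm (snd (snd q) (Suc t)))\<^sup>2)) \<partial>Q) =
      (\<Sum>t. \<integral>\<^sup>+q. ennreal ((\<alpha> t)\<^sup>2 * (norm (snd (snd q) (Suc t)))\<^sup>2) \<partial>Q)"
    by (rule nn_integral_suminf) measurable
  also have "\<dots> = (\<Sum>t. ennreal ((\<alpha> t)\<^sup>2 * ?V))"
    by (subst nn_integral_eq_integral) (auto simp: integrable_gaussian_coordinate)
  also have "\<dots> = ennreal (\<Sum>t. (\<alpha> t)\<^sup>2 * ?V)"
    using summable_mult2[OF alpha_square, of ?V] by (intro suminf_ennreal2) auto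
  finally have "(\<integral>\<^sup>+q. (\<Sum>t. ennreal ((\<alpha> t)\<^sup>2 * (norm (snd (snd q) (Suc t)))\<^sup>2)) \<partial>Q) \<noteq> \<infinity>" by simp
  then have "AE q in Q. (\<Sum>t. ennreal ((\<alpha> t)\<^sup>2 * (norm (snd (snd q) (Suc t)))\<^sup>2)) \<noteq> \<infinity>"
    by (rule nn_integral_noteq_infinite[rotated]) measurable
  then show ?thesis
    by eventually_elim (auto intro!: summable_suminf_not_top)
qed

text \<open>The indicator of \<open>|Y\<^sub>t| \<le> R\<close> makes the increments square integrable and has
  no effect along a bounded trajectory once \<open>R\<close> is large.\<close>

lemma AE_summable_truncated_noise:
  assumes [measurable]: "\<psi> \<in> borel_measurable borel" and L: "\<And>y. norm y \<le> R \<Longrightarrow> norm (\<psi> y) \<le> L"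
  shows "AE q in Q. summable (\<lambda>t. if norm (state t q) \<le> R then \<alpha> t * (\<psi> (state t q) \<bullet> noise t q) else 0)"
proof (rule Q.square_integrable_martingale_summable[where G=past, OF subalgebra_past])
  let ?D = "\<lambda>t q. if norm (state t q) \<le> R then \<alpha> t * (\<psi> (state t q) \<bullet> noise t q) else 0"
  let ?V = "\<integral>z. (norm z)\<^sup>2 \<partial>\<gamma>"
  have D_meas [measurable]: "?D t \<in> borel_measurable Q" for t by measurable
  \<comment> \<open>Increment \<open>i\<close> reads noise indices up to \<open>Suc i\<close>, hence
    at most \<open>j\<close>.\<close>
  show "?D i \<in> borel_measurable (past j)" if "i < j" for i j
    unfolding measurable_past_iff using that by (auto simp: state_resample noise_resample simp del: split_paired_All)
  \<comment> \<open>On \<open>|y| <= R\<close>, both \<open>|g|\<close> and \<open>|\<phi>|\<close>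
    are at most \<open>C (1 + R)\<close>, hence the factor 2.\<close>
  define B where "B = 2 * (C * (1 + R))"
  define U where "U t q = (\<alpha> t)\<^sup>2 * (L\<^sup>2 * (2 * B\<^sup>2 + 2 * a\<^sup>2 * (norm (snd (snd q) (Suc t)))\<^sup>2))"
    for t and q :: "'a \<times> (nat \<Rightarrow> 'b) \<times> (nat \<Rightarrow> 'a)"
  have U: "integrable Q (U t)" "Q.expectation (U t) = (\<alpha> t)\<^sup>2 * (L\<^sup>2 * (2 * B\<^sup>2 + 2 * a\<^sup>2 * ?V))" for t
    unfolding U_def[abs_def] using integrable_gaussian_coordinate[of "Suc t"]
    by (auto simp: Q.prob_space)
  have D_le: "(?D t q)\<^sup>2 \<le> U t q" for t q
  proof (cases "norm (state t q) \<le> R")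
    case True
    let ?e = "snd (snd q) (Suc t)"
    have b: "norm (g (state t q)) \<le> C * (1 + R)" "norm (\<phi> (state t q) x) \<le> C * (1 + R)" for x
      using True norm_g_le[of "state t q"] norm_phi_le[of "state t q" x]
        mult_left_mono[of "1 + norm (state t q)" "1 + R" C] C_nonneg by linarith+
    have "norm (noise t q) \<le> norm (g (state t q)) + norm (\<phi> (state t q) (fst (snd q) (Suc t))) + norm (a *\<^sub>R ?e)"
      unfolding noise_def by (smt (verit) norm_triangle_ineq norm_triangle_ineq4)
    also have "\<dots> \<le> B + a * norm ?e"
      using b(1) b(2)[of "fst (snd q) (Suc t)"] a_pos by (simp add: B_def)
    finally have n: "norm (noise t q) \<le> B + a * norm ?e" .
    have "(norm (noise t q))\<^sup>2 \<le> (B + a * norm ?e)\<^sup>2" using n by (intro power_mono) auto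
    also have "\<dots> \<le> 2 * B\<^sup>2 + 2 * a\<^sup>2 * (norm ?e)\<^sup>2"
      using sum_squares_bound[of B "a * norm ?e"] by (simp add: power2_sum power_mult_distrib)
    finally have n2: "(norm (noise t q))\<^sup>2 \<le> 2 * B\<^sup>2 + 2 * a\<^sup>2 * (norm ?e)\<^sup>2" .
    have "(\<psi> (state t q) \<bullet> noise t q)\<^sup>2 \<le> (norm (\<psi> (state t q)))\<^sup>2 * (norm (noise t q))\<^sup>2"
      using power_mono[OF Cauchy_Schwarz_ineq2[of "\<psi> (state t q)" "noise t q"], of 2] by (simp add: power_mult_distrib)
    also have "\<dots> \<le> L\<^sup>2 * (2 * B\<^sup>2 + 2 * a\<^sup>2 * (norm ?e)\<^sup>2)"
      using n2 L[OF True] by (intro mult_mono power_mono) auto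
    finally show ?thesis using True by (simp add: U_def power_mult_distrib mult_left_mono)
  qed (simp add: U_def)
  show D2: "integrable Q (\<lambda>q. (?D t q)\<^sup>2)" for t
  proof (rule Bochner_Integration.integrable_bound[OF U(1)[of t]])
    show "AE q in Q. norm ((?D t q)\<^sup>2) \<le> norm (U t q)"
      using D_le[of t] by (intro AE_I2) (smt (verit) real_norm_def zero_le_power2)
  qed measurable
  show "summable (\<lambda>t. Q.expectation (\<lambda>q. (?D t q)\<^sup>2))"
  proof (rule summable_comparison_test'[OF summable_mult2[OF alpha_square]])
    show "norm (Q.expectation (\<lambda>q. (?D t q)\<^sup>2)) \<le> (\<alpha> t)\<^sup>2 * (L\<^sup>2 * (2 * B\<^sup>2 + 2 * a\<^sup>2 * ?V))" for t
      unfolding U(2)[of t, symmetric] using integral_mono[OF D2 U(1) D_le, of t] by simp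
  qed
  \<comment> \<open>Index \<open>Suc j\<close> is resampled: \<open>X\<close> and
    \<open>state j\<close> do not change, while the fresh noise has mean zero, so the inner integral
    vanishes for every \<open>q\<close>.\<close>
  fix j and X :: "_ \<Rightarrow> real"
  assume X: "X \<in> borel_measurable (past j)" and i: "integrable Q (\<lambda>q. X q * ?D j q)"
  have [measurable]: "X \<in> borel_measurable Q" and Xr: "X (resample (Suc j) (q, p)) = X q" for q p
    using X by (auto simp: measurable_past_iff simp del: split_paired_All)
  have i': "integrable (Q \<Otimes>\<^sub>M (\<mu> \<Otimes>\<^sub>M \<gamma>)) (\<lambda>r. X (resample (Suc j) r) * ?D j (resample (Suc j) r))"
    using i by (subst (asm) distr_resample[of "Suc j", symmetric], subst (asm) integrable_distr_eq) auto
  have "Q.expectation (\<lambda>q. X q * ?D j q) =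
      (\<integral>r. X (resample (Suc j) r) * ?D j (resample (Suc j) r) \<partial>(Q \<Otimes>\<^sub>M (\<mu> \<Otimes>\<^sub>M \<gamma>)))"
    by (subst distr_resample[of "Suc j", symmetric], subst integral_distr) auto
  also have "\<dots> = (\<integral>q. \<integral>p. X (resample (Suc j) (q, p)) * ?D j (resample (Suc j) (q, p)) \<partial>(\<mu> \<Otimes>\<^sub>M \<gamma>) \<partial>Q)"
    by (rule QN.integral_fst'[symmetric]) (rule i')
  also have "\<dots> = (\<integral>q. 0 \<partial>Q)"
  proof (rule Bochner_Integration.integral_cong[OF refl])
    fix q
    have "X (resample (Suc j) (q, p)) * ?D j (resample (Suc j) (q, p)) =
        (X q * (if norm (state j q) \<le> R then \<alpha> j else 0)) *
          (\<psi> (state j q) \<bullet> (g (state j q) - \<phi> (state j q) (fst p) + a *\<^sub>R snd p))" for p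
      unfolding Xr by (simp add: state_resample noise_resample_Suc del: resample.simps)
    then show "(\<integral>p. X (resample (Suc j) (q, p)) * ?D j (resample (Suc j) (q, p)) \<partial>(\<mu> \<Otimes>\<^sub>M \<gamma>)) = 0"
      using integral_pair_noise[of "state j q"] by (simp only: integral_mult_right_zero integral_inner_right inner_zero_right mult_zero_right)
  qed
  finally show "Q.expectation (\<lambda>q. X q * ?D j q) = 0" by simp
qed

text \<open>If \<open>\<alpha> t = 0\<close> the state does not move. Otherwise, for every past and
  every direction, the fresh Gaussian enters with the nonzero factor \<open>\<alpha> t * a\<close>
  and almost surely avoids \<open>N\<close>.\<close>

lemma AE_state_notin_null:
  assumes N: "N \<in> null_sets lborel"
  shows "AE q in Q. state t q \<notin> N"
proof (induction t)
  case 0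
  have "N \<in> null_sets \<nu>" using N nu_ac by (auto simp: absolutely_continuous_def)
  then have "AE y in \<nu>. y \<notin> N" by (rule AE_not_in)
  moreover have d: "distr Q \<nu> fst = \<nu>" unfolding Q_def by (rule noises.distr_pair_fst)
  ultimately have "AE y in distr Q \<nu> fst. y \<notin> N" by (subst d)
  moreover have "fst \<in> Q \<rightarrow>\<^sub>M \<nu>" unfolding Q_def by measurable
  ultimately show ?case using AE_distrD[of fst Q \<nu> "\<lambda>y. y \<notin> N"] by simp
next
  case (Suc t)
  have [measurable]: "N \<in> sets borel" using N by auto
  show ?case
  proof (cases "\<alpha> t = 0")
    case True
    with Suc show ?thesis by simp
  next
    case False
    have fresh: "AE p in \<mu> \<Otimes>\<^sub>M \<gamma>. state (Suc t) (resample (Suc t) (q, p)) \<notin> N" for q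
    proof -
      have "AE z in \<gamma>. state t q - \<alpha> t *\<^sub>R \<phi> (state t q) x + (\<alpha> t * a) *\<^sub>R z \<notin> N" for x
        using False a_pos N by (intro AE_standard_gaussian_affine AE_not_in) auto
      then have ae: "AE x in \<mu>. AE z in \<gamma>. state (Suc t) (resample (Suc t) (q, (x, z))) \<notin> N"
        by (simp add: state_resample del: resample.simps)
      show ?thesis
        by (rule noise.AE_pair_measure[OF _ ae]) measurable
    qed
    have "AE r in Q \<Otimes>\<^sub>M (\<mu> \<Otimes>\<^sub>M \<gamma>). state (Suc t) (resample (Suc t) r) \<notin> N"
      by (rule QN.AE_pair_measure) (measurable, use fresh in simp)
    then have "AE q in distr (Q \<Otimes>\<^sub>M (\<mu> \<Otimes>\<^sub>M \<gamma>)) Q (resample (Suc t)). state (Suc t) q \<notin> N"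
      by (subst AE_distr_iff) measurable
    then show ?thesis by (simp only: distr_resample)
  qed
qed

lemma AE_gderiv_state: "AE q in Q. \<forall>t. GDERIV F (state t q) :> g (state t q)"
proof -
  \<comment> \<open>The set where the gradient fails is covered by a Borel null set, as its own
    measurability is not established.\<close>
  obtain N where N: "{y \<in> space lborel. \<not> GDERIV F y :> g y} \<subseteq> N" "emeasure lborel N = 0" "N \<in> sets lborel"
    using F_gderiv by (rule AE_E)
  then have "AE q in Q. \<forall>t. state t q \<notin> N"
    by (intro AE_all_countable[THEN iffD2] allI AE_state_notin_null) auto
  then show ?thesis by eventually_elim (use N(1) in auto)
qed

text \<open>Boundedness is used path by path: for a large natural radius the truncated noise series
  is the true one, and countably many radii leave one exceptional null set.\<close>

theorem AE_convergence:
  "AE q in Q. bounded (range (\<lambda>t. state t q)) \<longrightarrow>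
    convergent (\<lambda>t. F (state t q)) \<and>
    (\<forall>X r. strict_mono r \<and> (\<lambda>k. state (r k) q) \<longlonglongrightarrow> X \<longrightarrow> 0 \<in> clarke_subdifferential F X)"
proof -
  have g_bound: "norm (g y) \<le> C * (1 + R)" if "norm y \<le> R" for y R
    using norm_g_le[of y] mult_left_mono[of "1 + norm y" "1 + R" C] C_nonneg that by linarith
  have ae1: "AE q in Q. \<forall>R::nat. summable (\<lambda>t. if norm (state t q) \<le> R then \<alpha> t * (g (state t q) \<bullet> noise t q) else 0)"
    by (intro AE_all_countable[THEN iffD2] allI AE_summable_truncated_noise[OF g_measurable g_bound])
  have ae2: "AE q in Q. \<forall>R::nat. \<forall>b\<in>Basis. summable (\<lambda>t. if norm (state t q) \<le> R then \<alpha> t * (b \<bullet> noise t q) else 0)"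
    by (intro AE_all_countable[THEN iffD2] allI eventually_ball_finite ballI
        AE_summable_truncated_noise[where \<psi>="\<lambda>_. b" and L=1 for b]) auto
  show ?thesis
    using ae1 ae2 AE_summable_gaussian AE_gderiv_state
  proof eventually_elim
    case (elim q)
    show ?case
    proof (intro impI)
      assume "bounded (range (\<lambda>t. state t q))"
      then obtain R0 where R0: "\<And>t. norm (state t q) \<le> R0" by (auto simp: bounded_iff)
      obtain R :: nat where R: "R0 \<le> R" using real_arch_simple by blast
      have le: "norm (state t q) \<le> R" for t using R0[of t] R by simp
      let ?e = "\<lambda>t. snd (snd q) (Suc t)"
      define B where "B = C * (1 + real R)"
      have s1: "summable (\<lambda>t. \<alpha> t * (g (state t q) \<bullet> noise t q))"
        using elim(1)[rule_format, of R] by (simp add: le)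
      have s2: "summable (\<lambda>t. \<alpha> t * (b \<bullet> noise t q))" if "b \<in> Basis" for b
        using elim(2)[rule_format, OF that, of R] by (simp add: le)
      have "summable (\<lambda>t. \<Sum>b\<in>Basis. (\<alpha> t * (b \<bullet> noise t q)) *\<^sub>R b)"
        by (intro summable_sum summable_scaleR_left s2)
      moreover have "(\<Sum>b\<in>Basis. (\<alpha> t * (b \<bullet> noise t q)) *\<^sub>R b) = \<alpha> t *\<^sub>R noise t q" for t
        by (subst (2) euclidean_representation[symmetric])
          (simp add: scaleR_sum_right inner_commute)
      ultimately have s_noise: "summable (\<lambda>t. \<alpha> t *\<^sub>R noise t q)" by simp
      \<comment> \<open>Dominates the squared step: on this path \<open>|\<phi>| <= B\<close>, and
        \<open>(B + a |e|)^2 <= 2 B^2 + 2 a^2 |e|^2\<close>.\<close>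
      define c where "c t = (\<alpha> t)\<^sup>2 * (2 * B\<^sup>2 + 2 * a\<^sup>2 * (norm (?e t))\<^sup>2)" for t
      have "summable (\<lambda>t. (\<alpha> t)\<^sup>2 * (2 * B\<^sup>2) + (2 * a\<^sup>2) * ((\<alpha> t)\<^sup>2 * (norm (?e t))\<^sup>2))"
        using elim(3) alpha_square by (intro summable_add summable_mult summable_mult2)
      then have s_c: "summable c" by (simp add: c_def[abs_def] algebra_simps)
      have descent: "F (state (Suc t) q) \<le> F (state t q) - \<alpha> t * (norm (g (state t q)))\<^sup>2
          + \<alpha> t * (g (state t q) \<bullet> noise t q) + c t" for t
      proof -
        let ?d = "- \<phi> (state t q) (fst (snd q) (Suc t)) + a *\<^sub>R ?e t"
        have diff: "state (Suc t) q - state t q = \<alpha> t *\<^sub>R ?d" by (simp add: algebra_simps)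
        have "norm ?d \<le> norm (\<phi> (state t q) (fst (snd q) (Suc t))) + norm (a *\<^sub>R ?e t)"
          using norm_triangle_ineq[of "- \<phi> (state t q) (fst (snd q) (Suc t))" "a *\<^sub>R ?e t"] by simp
        also have "\<dots> \<le> B + a * norm (?e t)"
          using norm_phi_le[of "state t q" "fst (snd q) (Suc t)"] a_pos le[of t]
            mult_left_mono[of "1 + norm (state t q)" "1 + real R" C] C_nonneg by (simp add: B_def)
        finally have "(norm ?d)\<^sup>2 \<le> (B + a * norm (?e t))\<^sup>2" by (intro power_mono) auto
        also have "\<dots> \<le> 2 * B\<^sup>2 + 2 * a\<^sup>2 * (norm (?e t))\<^sup>2"
          using sum_squares_bound[of B "a * norm (?e t)"] by (simp add: power2_sum power_mult_distrib)
        finally have "(norm (state (Suc t) q - state t q))\<^sup>2 \<le> c t"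
          unfolding diff by (simp add: c_def power_mult_distrib mult_left_mono)
        moreover have "g (state t q) \<bullet> (state (Suc t) q - state t q) =
            - \<alpha> t * (norm (g (state t q)))\<^sup>2 + \<alpha> t * (g (state t q) \<bullet> noise t q)"
          unfolding state_Suc_eq by (simp add: inner_diff_right inner_add_right power2_norm_eq_inner)
        ultimately show ?thesis
          using F_descent[of "state (Suc t) q" "state t q"] by simp
      qed
      have h0: "0 \<le> \<alpha> t * (norm (g (state t q)))\<^sup>2" and c0: "0 \<le> c t" for t
        by (simp_all add: alpha_nonneg c_def)
      note conv = noisy_descent_convergent[of "\<lambda>t. F (state t q)", OF descent F_nonneg h0 c0 s1 s_c]
      have "0 \<in> clarke_subdifferential F X" if "strict_mono r" "(\<lambda>k. state (r k) q) \<longlonglongrightarrow> X" for X r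
      proof -
        \<comment> \<open>These times need not belong to the subsequence \<open>r\<close>, nor
          increase with \<open>i\<close>; the Clarke sub-differential only asks for points tending
          to \<open>X\<close> whose gradients converge.\<close>
        have "\<exists>t. dist (state t q) X < inverse (Suc i) \<and> norm (g (state t q)) < inverse (Suc i)" for i
          by (rule limit_point_small_gradient[OF alpha_nonneg alpha_diverges state_Suc_eq s_noise conv(2) that]) auto
        then obtain s where s: "\<And>i. dist (state (s i) q) X < inverse (Suc i)"
            "\<And>i. norm (g (state (s i) q)) < inverse (Suc i)"
          by metis
        have "(\<lambda>i. state (s i) q) \<longlonglongrightarrow> X"
          unfolding tendsto_dist_iff[of _ X]
          by (rule tendsto_sandwich[OF _ _ tendsto_const LIMSEQ_inverse_real_of_nat])
            (use s(1) in \<open>auto intro!: always_eventually less_imp_le\<close>)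
        moreover have "(\<lambda>i. g (state (s i) q)) \<longlonglongrightarrow> 0"
          by (rule Lim_null_comparison[OF _ LIMSEQ_inverse_real_of_nat])
            (use s(2) in \<open>auto intro!: always_eventually less_imp_le\<close>)
        ultimately show ?thesis
          unfolding clarke_subdifferential_def using elim(4)
          by (intro hull_inc CollectI exI[of _ "\<lambda>i. state (s i) q"] exI[of _ "\<lambda>i. g (state (s i) q)"]) auto
      qed
      with conv(1) show "convergent (\<lambda>t. F (state t q)) \<and>
        (\<forall>X r. strict_mono r \<and> (\<lambda>k. state (r k) q) \<longlonglongrightarrow> X \<longrightarrow> 0 \<in> clarke_subdifferential F X)"
        by blast
    qed
  qed
qed

end

section \<open>Application to sliced energies\<close>

text \<open>Each direction has marginal law \<open>\<mu>\<close> under \<open>Q\<close>. Applied to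
  the sphere, this identifies \<open>slope\<close> with \<open>phi\<close> along the
  trajectory.\<close>

lemma (in noisy_sgd) AE_directions:
  assumes "AE x in \<mu>. P x"
  shows "AE q in Q. \<forall>t. P (fst (snd q) t)"
proof (rule AE_all_countable[THEN iffD2], rule allI)
  fix t
  let ?S = "\<Pi>\<^sub>M t\<in>(UNIV::nat set). \<mu>" and ?T = "\<Pi>\<^sub>M t\<in>(UNIV::nat set). \<gamma>"
  have "AE w in ?S. P (w t)"
    by (rule AE_PiM_component[OF prob_mu UNIV_I assms])
  moreover have d1: "distr (?S \<Otimes>\<^sub>M ?T) ?S fst = ?S" by (rule gausss.distr_pair_fst)
  ultimately have "AE w in distr (?S \<Otimes>\<^sub>M ?T) ?S fst. P (w t)" by (subst d1)
  then have "AE r in ?S \<Otimes>\<^sub>M ?T. P (fst r t)" by (rule AE_distrD[OF measurable_fst])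
  moreover have d2: "distr Q (?S \<Otimes>\<^sub>M ?T) snd = ?S \<Otimes>\<^sub>M ?T"
    unfolding Q_def by (rule distr_pair_snd[OF prob_nu noises.sigma_finite_measure_axioms])
  ultimately have "AE r in distr Q (?S \<Otimes>\<^sub>M ?T) snd. P (fst r t)" by (subst d2)
  moreover have "snd \<in> Q \<rightarrow>\<^sub>M ?S \<Otimes>\<^sub>M ?T" unfolding Q_def by measurable
  ultimately show "AE q in Q. P (fst (snd q) t)" by (rule AE_distrD[rotated])
qed

theorem theorem4p3:
  fixes Z :: "real^'d^'n::{finite,linorder}"
    and \<tau> :: "real^'d^'n::_ \<Rightarrow> real^'d \<Rightarrow> 'n \<Rightarrow> 'n"
    and p :: nat and dirs :: "nat \<Rightarrow> real^'d"
    and F :: "real^'d^'n::_ \<Rightarrow> real" and \<mu> :: "(real^'d) measure"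
    and a :: real and \<nu> :: "(real^'d^'n::_) measure" and \<alpha> :: "nat \<Rightarrow> real"
    and M :: "'w measure"
    and Y :: "nat \<Rightarrow> 'w \<Rightarrow> real^'d^'n::_"
    and \<theta> :: "nat \<Rightarrow> 'w \<Rightarrow> real^'d"
    and \<epsilon> :: "nat \<Rightarrow> 'w \<Rightarrow> real^'d^'n::_"
  assumes tau: "sorting_choice \<tau>"
    and cases: "(F, \<mu>) = (energy sphere_uniform Z, sphere_uniform) \<or>
      (F, \<mu>) = (energy (empirical_measure {1..p} dirs) Z, empirical_measure {1..p} dirs) \<and> p \<ge> 1 \<and>
        (\<forall>i\<in>{1..p}. dirs i \<in> sphere 0 1) \<and> span (dirs ` {1..p}) = UNIV"
    and a: "a > 0"
    and nu: "prob_space \<nu>" "sets \<nu> = sets borel" "absolutely_continuous lborel \<nu>"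
    and alpha: "\<And>t. \<alpha> t \<ge> 0" "filterlim (\<lambda>T. \<Sum>t<T. \<alpha> t) at_top sequentially"
      "summable (\<lambda>t. (\<alpha> t)\<^sup>2)"
    and M: "prob_space M"
    and meas: "Y 0 \<in> borel_measurable M" "\<And>t. \<theta> t \<in> borel_measurable M"
      "\<And>t. \<epsilon> t \<in> borel_measurable M"
    and law: "distr M (borel \<Otimes>\<^sub>M ((\<Pi>\<^sub>M t\<in>UNIV. borel) \<Otimes>\<^sub>M (\<Pi>\<^sub>M t\<in>UNIV. borel)))
        (\<lambda>\<omega>. (Y 0 \<omega>, (\<lambda>t. \<theta> t \<omega>), (\<lambda>t. \<epsilon> t \<omega>)))
      = \<nu> \<Otimes>\<^sub>M ((\<Pi>\<^sub>M t\<in>UNIV. \<mu>) \<Otimes>\<^sub>M (\<Pi>\<^sub>M t\<in>UNIV. standard_gaussian))"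
    and step: "\<And>t \<omega>. \<omega> \<in> space M \<Longrightarrow>
      Y (Suc t) \<omega> = Y t \<omega> - \<alpha> t *\<^sub>R phi \<tau> Z (Y t \<omega>) (\<theta> (Suc t) \<omega>) + (\<alpha> t * a) *\<^sub>R \<epsilon> (Suc t) \<omega>"
    and bdd: "AE \<omega> in M. bounded (range (\<lambda>t. Y t \<omega>))"
  shows "(AE \<omega> in M. convergent (\<lambda>t. F (Y t \<omega>))) \<and>
    (AE \<omega> in M. \<forall>X r. strict_mono r \<and> (\<lambda>k. Y (r k) \<omega>) \<longlonglongrightarrow> X \<longrightarrow>
      X \<in> {X. 0 \<in> clarke_subdifferential F X})"
proof -
  have F: "F = energy \<mu> Z" using cases by auto
  have mu: "prob_space \<mu>" "sets \<mu> = sets borel" "AE \<theta> in \<mu>. \<theta> \<in> sphere 0 1"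
  proof -
    consider (sphere) "\<mu> = sphere_uniform"
      | (directions) "\<mu> = empirical_measure {1..p} dirs" "p \<ge> 1" "\<forall>i\<in>{1..p}. dirs i \<in> sphere 0 1"
      using cases by blast
    then have "prob_space \<mu> \<and> sets \<mu> = sets borel \<and> (AE \<theta> in \<mu>. \<theta> \<in> sphere 0 1)"
    proof cases
      case sphere
      have "sets (sphere_uniform :: (real^'d) measure) = sets borel" by (simp add: sphere_uniform_def)
      then show ?thesis unfolding sphere using prob_space_sphere_uniform AE_sphere_uniform by blast
    next
      case directions
      have "AE \<theta> in \<mu>. \<theta> \<in> sphere 0 1"
        using AE_empirical_measure[OF finite_atLeastAtMost, of dirs 1 p]
        unfolding directions(1) by eventually_elim (use directions(3) in auto)
      with directions show ?thesis by (simp add: prob_space_empirical_measure)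
    qed
    then show "prob_space \<mu>" "sets \<mu> = sets borel" "AE \<theta> in \<mu>. \<theta> \<in> sphere 0 1" by auto
  qed
  interpret E: sliced_energy Z \<tau> \<mu>
    by (rule sliced_energy.intro) (fact tau mu)+
  \<comment> \<open>Turns the bound \<open>2 (|X| + |Z|)\<close> into linear growth with a constant
    depending only on \<open>Z\<close>.\<close>
  have "norm (E.slope X \<eta>) \<le> 2 * (1 + norm Z) * (1 + norm X)" for X \<eta>
  proof -
    have "norm X + norm Z \<le> (1 + norm Z) * (1 + norm X)" by (simp add: algebra_simps)
    then have "2 * (norm X + norm Z) \<le> 2 * (1 + norm Z) * (1 + norm X)" unfolding mult.assoc by simp
    with E.norm_slope_le show ?thesis by (rule order_trans)
  qed
  then interpret S: noisy_sgd E.slope E.mean_slope F \<mu> \<nu> \<alpha> a "2 * (1 + norm Z)"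
    unfolding F
    by (intro noisy_sgd.intro mu nu alpha a E.slope_measurable E.mean_slope_def E.energy_nonneg
        E.energy_descent E.AE_gderiv_energy)
  define \<Phi> where "\<Phi> \<omega> = (Y 0 \<omega>, (\<lambda>t. \<theta> t \<omega>), (\<lambda>t. \<epsilon> t \<omega>))" for \<omega>
  have \<Phi>: "\<Phi> \<in> M \<rightarrow>\<^sub>M borel \<Otimes>\<^sub>M ((\<Pi>\<^sub>M t\<in>UNIV. borel) \<Otimes>\<^sub>M (\<Pi>\<^sub>M t\<in>UNIV. borel))"
    unfolding \<Phi>_def[abs_def] using meas by (intro measurable_Pair measurable_PiM_single') auto
  have d: "distr M (borel \<Otimes>\<^sub>M ((\<Pi>\<^sub>M t\<in>UNIV. borel) \<Otimes>\<^sub>M (\<Pi>\<^sub>M t\<in>UNIV. borel))) \<Phi> = S.Q"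
    unfolding \<Phi>_def[abs_def] S.Q_def by (rule law)
  \<comment> \<open>The driving variables have law \<open>S.Q\<close>, so almost sure statements on
    the canonical space pull back along \<open>\<Phi>\<close>.\<close>
  have transfer: "AE \<omega> in M. P (\<Phi> \<omega>)" if "AE q in S.Q. P q" for P
    by (rule AE_distrD[OF \<Phi>]) (subst d, rule that)
  have "AE \<omega> in M. \<forall>t. \<theta> t \<omega> \<in> sphere 0 1"
    using transfer[OF S.AE_directions[OF mu(3)]] by (simp add: \<Phi>_def)
  \<comment> \<open>When all directions lie on the sphere, \<open>slope\<close> and
    \<open>phi\<close> agree and both recursions produce the same path.\<close>
  then have state: "AE \<omega> in M. \<forall>t. Y t \<omega> = S.state t (\<Phi> \<omega>)"
    using AE_space
  proof eventually_elim
    case (elim \<omega>)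
    show ?case
    proof
      fix t show "Y t \<omega> = S.state t (\<Phi> \<omega>)"
      proof (induction t)
        case (Suc t)
        have "E.slope (Y t \<omega>) (\<theta> (Suc t) \<omega>) = phi \<tau> Z (Y t \<omega>) (\<theta> (Suc t) \<omega>)"
          using elim(1) by (simp add: E.slope_def)
        then show ?case
          using step[OF elim(2), of t] by (simp add: Suc[symmetric]) (simp add: \<Phi>_def)
      qed (simp add: \<Phi>_def)
    qed
  qed
  have "AE \<omega> in M. convergent (\<lambda>t. F (Y t \<omega>)) \<and>
    (\<forall>X r. strict_mono r \<and> (\<lambda>k. Y (r k) \<omega>) \<longlonglongrightarrow> X \<longrightarrow> X \<in> {X. 0 \<in> clarke_subdifferential F X})"
    using transfer[OF S.AE_convergence] state bdd
    by eventually_elim simp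
  then show ?thesis by (simp only: AE_conj_iff)
qed

end
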